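(* Let $M=(M_t)_{t\in\mathbb{R}}$ be a given càdlàg process. The following are equivalent: (a) $M_{-\infty}:=\lim_{s\to-\infty}M_s$ exists $P$-a.s. and $(M_t-M_{-\infty})_{t\in\mathbb{R}}$ is in $\mathcal{M}(\mathcal{F}_{\cdot})$. (b) $M\in\mathcal{IM}(\mathcal{F}_{\cdot})$ and $({}^{s}M_0)_{s<0}$ is uniformly integrable. Likewise, the following are equivalent: (c) $M_{-\infty}:=\lim_{s\to-\infty}M_s$ exists $P$-a.s. and $(M_t-M_{-\infty})_{t\in\mathbb{R}}$ is in $\mathcal{M}^2(\mathcal{F}_{\cdot})$. (d) $M\in\mathcal{IM}^2(\mathcal{F}_{\cdot})$ and $\sup_{s:\,s\le 0}E[({}^{s}M_0)^2]<\infty$.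
   Context: $(\Omega,\mathcal{F},P)$ is a complete probability space and $\mathcal{F}_{\cdot}=(\mathcal{F}_t)_{t\in\mathbb{R}}$ is a filtration: a right-continuous increasing family of sub-$\sigma$-algebras of $\mathcal{F}$, each containing all $P$-null sets. A process $X=(X_t)_{t\in\mathbb{R}}$ is càdlàg if all its paths are right-continuous with left limits in $\mathbb{R}$. "$\lim_{s\to-\infty}X_s$ exists $P$-a.s." means that $X_s$ converges almost surely, as $s\to-\infty$, to a finite limit. For a process $X$ and $s\in\mathbb{R}$, the increment process ${}^{s}X=({}^{s}X_t)_{t\in\mathbb{R}}$ is ${}^{s}X_t:=X_t-X_{t\wedge s}$, i.e. $0$ if $t\le s$ and $X_t-X_s$ if $t\ge s$. $\mathcal{M}(\mathcal{F}_{\cdot})$ is the class of martingales indexed by $\mathbb{R}$: càdlàg adapted integrable processes $M$ with $E[M_t\mid\mathcal{F}_s]=M_s$ $P$-a.s. for all $s<t$. $\mathcal{M}^2(\mathcal{F}_{\cdot})$ is the subclass for which $M_t$ is square integrable for all $t\in\mathbb{R}$. $\mathcal{IM}(\mathcal{F}_{\cdot})$ (increment martingales) is the class of càdlàg processes $M$, not necessarily adapted, with ${}^{s}M\in\mathcal{M}(\mathcal{F}_{\cdot})$ for all $s\in\mathbb{R}$. $\mathcal{IM}^2(\mathcal{F}_{\cdot})$ (increment square integrable martingales) is the subclass for which all increments are square integrable, i.e. ${}^{s}M\in\mathcal{M}^2(\mathcal{F}_{\cdot})$ for all $s$. *)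

theory Defs
  imports "HOL-Probability.Probability"
begin

text \<open>
  The \<open>\<sigma>\<close>-algebras \<open>F t\<close> are given as measure spaces of which only the space and the measurable
  sets matter; the probability measure is always \<open>P\<close>.
\<close>

locale complete_filtered_prob_space =
  prob_space P + complete_measure P + filtration "space P" F
  for P :: "'a measure" and F :: "real \<Rightarrow> 'a measure" +
  assumes subalgebra_F: "\<And>t. subalgebra P (F t)"
    and null_sets_F: "\<And>t. null_sets P \<subseteq> sets (F t)"
    and right_continuous_F: "\<And>t. sets (F t) = (\<Inter>s\<in>{t<..}. sets (F s))"

definition cadlag_process :: "'a measure \<Rightarrow> (real \<Rightarrow> 'a \<Rightarrow> real) \<Rightarrow> bool" where
  "cadlag_process P X \<longleftrightarrow>
     (\<forall>t. X t \<in> borel_measurable P) \<and>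
     (\<forall>\<omega>\<in>space P. \<forall>t. continuous (at_right t) (\<lambda>s. X s \<omega>) \<and>
                        (\<exists>l. ((\<lambda>s. X s \<omega>) \<longlongrightarrow> l) (at_left t)))"

definition incr :: "real \<Rightarrow> (real \<Rightarrow> 'a \<Rightarrow> real) \<Rightarrow> real \<Rightarrow> 'a \<Rightarrow> real" where
  "incr s X t \<omega> = X t \<omega> - X (min t s) \<omega>"

definition has_lim_minus_inf :: "(real \<Rightarrow> 'a \<Rightarrow> real) \<Rightarrow> 'a \<Rightarrow> bool" where
  "has_lim_minus_inf X \<omega> \<longleftrightarrow> (\<exists>l. ((\<lambda>s. X s \<omega>) \<longlongrightarrow> l) at_bot)"

text \<open>
  The value 0 where there is no limit is immaterial: \<open>lim_minus_inf\<close> is used for processes that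
  converge almost surely, and every \<open>F t\<close> contains all null sets.
\<close>

definition lim_minus_inf :: "(real \<Rightarrow> 'a \<Rightarrow> real) \<Rightarrow> 'a \<Rightarrow> real" where
  "lim_minus_inf X \<omega> = (if has_lim_minus_inf X \<omega> then Lim at_bot (\<lambda>s. X s \<omega>) else 0)"

definition martingales ::
    "'a measure \<Rightarrow> (real \<Rightarrow> 'a measure) \<Rightarrow> (real \<Rightarrow> 'a \<Rightarrow> real) set" where
  "martingales P F =
     {X. cadlag_process P X \<and>
         (\<forall>t. X t \<in> borel_measurable (F t)) \<and>
         (\<forall>t. integrable P (X t)) \<and>
         (\<forall>s t. s < t \<longrightarrow> (AE \<omega> in P. real_cond_exp P (F s) (X t) \<omega> = X s \<omega>))}"

definition square_integrable_martingales ::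
    "'a measure \<Rightarrow> (real \<Rightarrow> 'a measure) \<Rightarrow> (real \<Rightarrow> 'a \<Rightarrow> real) set" where
  "square_integrable_martingales P F =
     {X \<in> martingales P F. \<forall>t. integrable P (\<lambda>\<omega>. (X t \<omega>)\<^sup>2)}"

definition increment_martingales ::
    "'a measure \<Rightarrow> (real \<Rightarrow> 'a measure) \<Rightarrow> (real \<Rightarrow> 'a \<Rightarrow> real) set" where
  "increment_martingales P F =
     {X. cadlag_process P X \<and> (\<forall>s. incr s X \<in> martingales P F)}"

definition increment_square_integrable_martingales ::
    "'a measure \<Rightarrow> (real \<Rightarrow> 'a measure) \<Rightarrow> (real \<Rightarrow> 'a \<Rightarrow> real) set" where
  "increment_square_integrable_martingales P F =
     {X \<in> increment_martingales P F. \<forall>s. incr s X \<in> square_integrable_martingales P F}"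

definition uniformly_integrable :: "'a measure \<Rightarrow> 'i set \<Rightarrow> ('i \<Rightarrow> 'a \<Rightarrow> real) \<Rightarrow> bool" where
  "uniformly_integrable P I Y \<longleftrightarrow>
     (\<forall>i\<in>I. Y i \<in> borel_measurable P) \<and>
     ((\<lambda>c::real. SUP i\<in>I. \<integral>\<^sup>+\<omega>. ennreal \<bar>Y i \<omega>\<bar> * indicator {\<omega>. c < \<bar>Y i \<omega>\<bar>} \<omega> \<partial>P) \<longlongrightarrow> 0) at_top"

end

theory Submission
  imports Defs
begin

text \<open>
  The main step is (b) to (a). For \<open>u \<le> t\<close> put \<open>h u t = E \<phi>(M t - M u)\<close>, where \<open>\<phi>\<close> is the Huber function,
  which is quadratic near \<open>0\<close> and linear at infinity. As \<open>M - M u\<close> is a martingale on \<open>[u, \<infinity>)\<close> and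
  \<open>\<phi>\<close> is convex, \<open>h u\<close> is increasing; as \<open>\<phi>\<close> is quadratic near \<open>0\<close>, an increment with
  \<open>E |M t - M s| > e\<close> raises \<open>h u\<close> by a fixed amount that does not depend on \<open>u\<close>. Since the
  increments are bounded in \<open>L\<^sup>1\<close>, so is \<open>h\<close>; hence there is no arbitrarily long chain of such
  intervals, and \<open>M\<close> is \<open>L\<^sup>1\<close>-Cauchy at \<open>-\<infinity>\<close>. If \<open>L\<close> is its limit, then \<open>M - L\<close> is a martingale that
  tends to \<open>0\<close> in \<open>L\<^sup>1\<close>, and by Doob's maximal inequality almost surely.

  Conversely, a martingale \<open>N\<close> satisfies \<open>N s = E[N 0 | F s]\<close> for \<open>s < 0\<close>, which gives uniform
  integrability. In the square integrable case the bound passes to the limit by Fatou's lemma, and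
  in the other direction \<open>E (N 0 - N s)\<^sup>2 = E (N 0)\<^sup>2 - E (N s)\<^sup>2\<close>.
\<close>

subsection \<open>The Huber function\<close>

text \<open>\<open>huber l\<close> is \<open>x\<^sup>2\<close> on \<open>[-l, l]\<close> and \<open>2 l |x| - l\<^sup>2\<close> outside; its derivative is \<open>2 * clip l\<close>.\<close>

definition clip :: "real \<Rightarrow> real \<Rightarrow> real" where
  "clip l x = max (- l) (min l x)"

definition huber :: "real \<Rightarrow> real \<Rightarrow> real" where
  "huber l x = 2 * clip l x * x - (clip l x)\<^sup>2"

lemma borel_measurable_clip [measurable]: "clip l \<in> borel_measurable borel"
  unfolding clip_def by measurable

lemma borel_measurable_huber [measurable]: "huber l \<in> borel_measurable borel"
  unfolding huber_def by measurable

lemma abs_clip_le: "0 \<le> l \<Longrightarrow> \<bar>clip l x\<bar> \<le> l"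
  by (auto simp: clip_def)

text \<open>The remainder of the first-order expansion of \<open>huber l\<close> at \<open>x\<close>.\<close>

definition huber_gap :: "real \<Rightarrow> real \<Rightarrow> real \<Rightarrow> real" where
  "huber_gap l x y = huber l y - huber l x - 2 * clip l x * (y - x)"

lemma huber_gap_eq:
  assumes "\<bar>x\<bar> \<le> l \<and> \<bar>y\<bar> \<le> l"
  shows "huber_gap l x y = (y - x)\<^sup>2"
proof -
  have "clip l x = x" "clip l y = y" using assms by (auto simp: clip_def)
  then show ?thesis by (simp add: huber_gap_def huber_def power2_eq_square algebra_simps)
qed

text \<open>The remainder factors as
  \<open>(clip l y - clip l x) * (2 * y - clip l y - clip l x)\<close>, that is
  \<open>(y - clip l x)\<^sup>2 - (y - clip l y)\<^sup>2\<close>. It is nonnegative because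
  \<open>clip l y\<close> is the point of \<open>[-l, l]\<close> nearest to \<open>y\<close>. This
  is the convexity of \<open>huber l\<close>.\<close>

lemma huber_gap_nonneg:
  assumes "0 \<le> l"
  shows "0 \<le> huber_gap l x y"
proof -
  have "0 \<le> (clip l y - clip l x) * (2 * y - clip l y - clip l x)"
    using assms by (auto simp: clip_def max_def min_def zero_le_mult_iff)
  then show ?thesis
    by (simp add: huber_gap_def huber_def power2_eq_square algebra_simps)
qed

lemma huber_0 [simp]: "0 \<le> l \<Longrightarrow> huber l 0 = 0"
  by (simp add: huber_def clip_def)

lemma huber_nonneg: "0 \<le> l \<Longrightarrow> 0 \<le> huber l x"
  using huber_gap_nonneg[of l 0 x] by (simp add: huber_gap_def clip_def)

lemma huber_le: "0 \<le> l \<Longrightarrow> huber l x \<le> 2 * l * \<bar>x\<bar>"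
proof -
  assume l: "0 \<le> l"
  have "huber l x \<le> 2 * (clip l x * x)" by (simp add: huber_def)
  also have "clip l x * x \<le> \<bar>clip l x\<bar> * \<bar>x\<bar>" by (metis abs_ge_self abs_mult)
  also have "\<dots> \<le> l * \<bar>x\<bar>" using abs_clip_le[OF l] by (intro mult_right_mono) auto
  finally show ?thesis by simp
qed

lemma integrable_huber:
  fixes f :: "'a \<Rightarrow> real"
  assumes "0 \<le> l" and f: "integrable M f"
  shows "integrable M (\<lambda>x. huber l (f x))"
proof (rule Bochner_Integration.integrable_bound[where f="\<lambda>x. 2 * l * f x"])
  have [measurable]: "f \<in> borel_measurable M" using f by auto
  show "(\<lambda>x. huber l (f x)) \<in> borel_measurable M" by measurable
  show "AE x in M. norm (huber l (f x)) \<le> norm (2 * l * f x)"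
    using huber_le[of l] huber_nonneg[of l] assms(1) by (auto simp: abs_mult)
qed (use f in simp)

subsection \<open>Uniform integrability\<close>

text \<open>The integrand of the uniform integrability condition as a real function, so that Bochner
  integrals can replace the \<open>ennreal\<close> ones.\<close>

definition tail :: "real \<Rightarrow> real \<Rightarrow> real" where
  "tail c x = (if c < \<bar>x\<bar> then \<bar>x\<bar> else 0)"

lemma borel_measurable_tail [measurable]: "tail c \<in> borel_measurable borel"
  unfolding tail_def by measurable

lemma tail_nonneg: "0 \<le> tail c x"
  by (simp add: tail_def)

lemma tail_antimono: "c \<le> c' \<Longrightarrow> tail c' x \<le> tail c x"
  by (simp add: tail_def)

lemma abs_le_add_tail: "0 \<le> c \<Longrightarrow> \<bar>x\<bar> \<le> c + tail c x"
  by (simp add: tail_def)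

text \<open>If \<open>|x - y|\<close> exceeds \<open>2 * c\<close>, then the larger of
  \<open>|x|\<close> and \<open>|y|\<close> exceeds \<open>c\<close>, and \<open>|x - y|\<close> is
  at most twice that one.\<close>

lemma tail_diff_le: "tail (2 * c) (x - y) \<le> 2 * tail c x + 2 * tail c y"
  by (auto simp: tail_def abs_if split: if_splits)

lemma integrable_tail:
  fixes f :: "'a \<Rightarrow> real"
  assumes "integrable M f"
  shows "integrable M (\<lambda>x. tail c (f x))"
proof -
  have [measurable]: "f \<in> borel_measurable M" using assms by auto
  show ?thesis
    using assms by (rule Bochner_Integration.integrable_bound) (measurable, auto simp: tail_def)
qed

text \<open>Makes \<open>L\<^sup>2\<close>-bounded families uniformly integrable: where
  \<open>|x|\<close> exceeds \<open>c\<close>, multiplying by \<open>|x|\<close> gives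
  \<open>c * |x| \<le> x\<^sup>2\<close>.\<close>

lemma tail_le_square: "0 < c \<Longrightarrow> tail c x \<le> x\<^sup>2 / c"
proof -
  assume c: "0 < c"
  have "c * \<bar>x\<bar> \<le> \<bar>x\<bar> * \<bar>x\<bar>" if "c < \<bar>x\<bar>"
    using that by (intro mult_right_mono) auto
  then show ?thesis using c by (auto simp: tail_def field_simps power2_eq_square)
qed

lemma integrable_mult_of_squares:
  fixes f g :: "'a \<Rightarrow> real"
  assumes [measurable]: "f \<in> borel_measurable M" "g \<in> borel_measurable M"
    and "integrable M (\<lambda>x. (f x)\<^sup>2)" "integrable M (\<lambda>x. (g x)\<^sup>2)"
  shows "integrable M (\<lambda>x. f x * g x)"
proof (rule Bochner_Integration.integrable_bound[where f="\<lambda>x. (f x)\<^sup>2 + (g x)\<^sup>2"])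
  have "\<bar>a * b\<bar> \<le> \<bar>a\<^sup>2 + b\<^sup>2\<bar>" for a b :: real
  proof -
    have "0 \<le> \<bar>a * b\<bar>" by simp
    moreover have "2 * \<bar>a * b\<bar> \<le> a\<^sup>2 + b\<^sup>2"
      using sum_squares_bound[of "\<bar>a\<bar>" "\<bar>b\<bar>"] by (simp add: abs_mult)
    ultimately show ?thesis by linarith
  qed
  then show "AE x in M. norm (f x * g x) \<le> norm ((f x)\<^sup>2 + (g x)\<^sup>2)" by simp
qed (use assms in auto)

lemma integrable_diff_square:
  fixes f g :: "'a \<Rightarrow> real"
  assumes "f \<in> borel_measurable M" "g \<in> borel_measurable M"
    and "integrable M (\<lambda>x. (f x)\<^sup>2)" "integrable M (\<lambda>x. (g x)\<^sup>2)"
  shows "integrable M (\<lambda>x. (f x - g x)\<^sup>2)"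
  using assms integrable_mult_of_squares[OF assms] by (auto simp: power2_diff mult.assoc)

text \<open>Dominated convergence along integer thresholds with majorant \<open>|f|\<close>: a point
  leaves the tail once the threshold reaches \<open>|f x|\<close>.\<close>

lemma integral_tail_small:
  fixes f :: "'a \<Rightarrow> real"
  assumes f: "integrable M f" and "0 < e"
  shows "\<exists>c>0. (\<integral>x. tail c (f x) \<partial>M) \<le> e"
proof -
  have [measurable]: "f \<in> borel_measurable M" using f by auto
  have "(\<lambda>n. \<integral>x. tail (real n) (f x) \<partial>M) \<longlonglongrightarrow> (\<integral>x. 0 \<partial>M)"
  proof (rule integral_dominated_convergence[where w="\<lambda>x. \<bar>f x\<bar>"])
    show "AE x in M. (\<lambda>n. tail (real n) (f x)) \<longlonglongrightarrow> 0"
    proof (rule AE_I2)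
      fix x
      have "\<forall>\<^sub>F n in sequentially. tail (real n) (f x) = 0"
        using eventually_ge_at_top[of "nat \<lceil>\<bar>f x\<bar>\<rceil>"]
        by eventually_elim (auto simp: tail_def)
      then show "(\<lambda>n. tail (real n) (f x)) \<longlonglongrightarrow> 0" by (rule tendsto_eventually)
    qed
  qed (use f in \<open>auto simp: tail_def\<close>)
  then have "\<forall>\<^sub>F n in sequentially. (\<integral>x. tail (real n) (f x) \<partial>M) < e"
    using \<open>0 < e\<close> by (auto intro: order_tendstoD)
  then have "\<forall>\<^sub>F n in sequentially. 0 < n \<and> (\<integral>x. tail (real n) (f x) \<partial>M) < e"
    using eventually_gt_at_top[of 0] by eventually_elim auto
  then obtain n where "0 < n" "(\<integral>x. tail (real n) (f x) \<partial>M) < e"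
    by (auto simp: eventually_sequentially)
  then show ?thesis by (intro exI[of _ "real n"]) auto
qed

text \<open>Integrability turns each nonnegative integral into a finite Bochner integral. As
  \<open>tail c\<close> decreases in \<open>c\<close>, convergence to 0 amounts to one good
  threshold for each \<open>e\<close>.\<close>

lemma uniformly_integrable_iff_tail:
  assumes Y: "\<And>i. i \<in> I \<Longrightarrow> integrable M (Y i)"
  shows "uniformly_integrable M I Y \<longleftrightarrow> (\<forall>e>0. \<exists>c>0. \<forall>i\<in>I. (\<integral>x. tail c (Y i x) \<partial>M) \<le> e)"
proof -
  have eq: "(\<integral>\<^sup>+x. ennreal \<bar>Y i x\<bar> * indicator {x. c < \<bar>Y i x\<bar>} x \<partial>M) = ennreal (\<integral>x. tail c (Y i x) \<partial>M)"
    if "i \<in> I" for i c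
  proof -
    have "(\<integral>\<^sup>+x. ennreal \<bar>Y i x\<bar> * indicator {x. c < \<bar>Y i x\<bar>} x \<partial>M) = (\<integral>\<^sup>+x. ennreal (tail c (Y i x)) \<partial>M)"
      by (intro nn_integral_cong) (auto simp: tail_def indicator_def)
    also have "\<dots> = ennreal (\<integral>x. tail c (Y i x) \<partial>M)"
      using integrable_tail[OF Y[OF that]] by (intro nn_integral_eq_integral) (auto simp: tail_nonneg)
    finally show ?thesis .
  qed
  let ?S = "\<lambda>c. SUP i\<in>I. ennreal (\<integral>x. tail c (Y i x) \<partial>M)"
  have "uniformly_integrable M I Y \<longleftrightarrow> (?S \<longlongrightarrow> 0) at_top"
    using Y unfolding uniformly_integrable_def by (auto simp: eq cong: SUP_cong)
  also have "\<dots> \<longleftrightarrow> (\<forall>e>0. \<exists>c>0. \<forall>i\<in>I. (\<integral>x. tail c (Y i x) \<partial>M) \<le> e)"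
  proof safe
    fix e :: real assume "(?S \<longlongrightarrow> 0) at_top" "0 < e"
    then have "\<forall>\<^sub>F c in at_top. ?S c < ennreal e"
      by (intro order_tendstoD) auto
    then have "\<forall>\<^sub>F c in at_top. 0 < c \<and> ?S c < ennreal e"
      using eventually_gt_at_top[of 0] by eventually_elim auto
    then obtain c where c: "0 < c" "?S c < ennreal e"
      by (auto simp: eventually_at_top_linorder)
    have "(\<integral>x. tail c (Y i x) \<partial>M) \<le> e" if "i \<in> I" for i
    proof -
      have "ennreal (\<integral>x. tail c (Y i x) \<partial>M) \<le> ?S c" using that by (rule SUP_upper)
      then have "ennreal (\<integral>x. tail c (Y i x) \<partial>M) \<le> ennreal e" using c(2) by simp
      then show ?thesis using \<open>0 < e\<close> by simp
    qed
    then show "\<exists>c>0. \<forall>i\<in>I. (\<integral>x. tail c (Y i x) \<partial>M) \<le> e" using c(1) by blast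
  next
    assume *: "\<forall>e>0. \<exists>c>0. \<forall>i\<in>I. (\<integral>x. tail c (Y i x) \<partial>M) \<le> e"
    show "(?S \<longlongrightarrow> 0) at_top"
    proof (rule order_tendstoI)
      fix a :: ennreal assume "0 < a"
      \<comment> \<open>\<open>a\<close> may be infinite, and a supremum inherits only weak
        inequalities; hence a finite \<open>e\<close> strictly below \<open>a\<close>.\<close>
      then obtain e where e: "0 < ennreal e" "ennreal e < a"
        by (metis dense ennreal_cases order_less_imp_not_less ennreal_less_top not_less_iff_gr_or_eq top.not_eq_extremum)
      then have "0 < e" by simp
      with * obtain c where c: "\<And>i. i \<in> I \<Longrightarrow> (\<integral>x. tail c (Y i x) \<partial>M) \<le> e" by blast
      have "?S c' < a" if "c \<le> c'" for c'
      proof -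
        have "(\<integral>x. tail c' (Y i x) \<partial>M) \<le> e" if "i \<in> I" for i
        proof -
          have "(\<integral>x. tail c' (Y i x) \<partial>M) \<le> (\<integral>x. tail c (Y i x) \<partial>M)"
            using Y[OF that] \<open>c \<le> c'\<close> by (intro integral_mono integrable_tail tail_antimono)
          then show ?thesis using c[OF that] by simp
        qed
        then have "?S c' \<le> ennreal e" by (intro SUP_least ennreal_leI)
        then show ?thesis using e(2) by simp
      qed
      then show "\<forall>\<^sub>F c' in at_top. ?S c' < a"
        unfolding eventually_at_top_linorder by blast
    qed auto
  qed
  finally show ?thesis .
qed

text \<open>Fatou's lemma, with the bound asked for only eventually: along a sequence of times
  tending to minus infinity, the Cauchy estimate for increments up to \<open>t\<close> applies once
  the sequence has passed below \<open>t\<close>.\<close>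

lemma nn_integral_le_of_AE_tendsto:
  fixes f :: "nat \<Rightarrow> 'a \<Rightarrow> real"
  assumes [measurable]: "\<And>k. f k \<in> borel_measurable M"
    and lim: "AE x in M. (\<lambda>k. f k x) \<longlonglongrightarrow> g x"
    and bound: "\<forall>\<^sub>F k in sequentially. (\<integral>\<^sup>+x. ennreal (f k x) \<partial>M) \<le> K"
  shows "(\<integral>\<^sup>+x. ennreal (g x) \<partial>M) \<le> K"
proof -
  have "(\<integral>\<^sup>+x. ennreal (g x) \<partial>M) = (\<integral>\<^sup>+x. liminf (\<lambda>k. ennreal (f k x)) \<partial>M)"
  proof (rule nn_integral_cong_AE)
    show "AE x in M. ennreal (g x) = liminf (\<lambda>k. ennreal (f k x))"
      using lim by eventually_elim (auto intro!: lim_imp_Liminf[symmetric] tendsto_ennrealI)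
  qed
  also have "\<dots> \<le> liminf (\<lambda>k. \<integral>\<^sup>+x. ennreal (f k x) \<partial>M)"
    by (intro nn_integral_liminf) measurable
  also have "\<dots> \<le> liminf (\<lambda>k. K)"
    by (intro Liminf_mono bound)
  finally show ?thesis by (simp add: Liminf_const)
qed

subsection \<open>Increments of processes\<close>

lemma incr_eq: "s \<le> t \<Longrightarrow> incr s X t = (\<lambda>\<omega>. X t \<omega> - X s \<omega>)"
  by (auto simp: incr_def fun_eq_iff)

lemma incr_shift: "incr s (\<lambda>t \<omega>. X t \<omega> - Z \<omega>) = incr s X"
  by (simp add: incr_def fun_eq_iff)

lemma lim_minus_infI:
  assumes "((\<lambda>s. X s \<omega>) \<longlongrightarrow> l) at_bot"
  shows "has_lim_minus_inf X \<omega>" "lim_minus_inf X \<omega> = l"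
proof -
  show "has_lim_minus_inf X \<omega>" using assms by (auto simp: has_lim_minus_inf_def)
  then show "lim_minus_inf X \<omega> = l"
    using tendsto_Lim[OF _ assms] by (simp add: lim_minus_inf_def)
qed

lemma lim_minus_inf_tendsto:
  assumes "has_lim_minus_inf X \<omega>"
  shows "((\<lambda>s. X s \<omega>) \<longlongrightarrow> lim_minus_inf X \<omega>) at_bot"
  using assms lim_minus_infI unfolding has_lim_minus_inf_def by metis

text \<open>On each side of \<open>t\<close> the process is locally either 0 or
  \<open>X - X s\<close>. The boundary point \<open>t = s\<close> belongs to the second case from
  the right and to the first from the left, so the two case splits differ.\<close>

lemma cadlag_incr:
  assumes X: "cadlag_process P X"
  shows "cadlag_process P (incr s X)"
  unfolding cadlag_process_def
proof (intro conjI allI ballI)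
  show "incr s X t \<in> borel_measurable P" for t
    using X unfolding incr_def cadlag_process_def by (intro borel_measurable_diff) auto
next
  fix \<omega> t assume \<omega>: "\<omega> \<in> space P"
  then have c: "((\<lambda>r. X r \<omega>) \<longlongrightarrow> X t \<omega>) (at_right t)"
    using X by (auto simp: cadlag_process_def continuous_within)
  show "continuous (at_right t) (\<lambda>r. incr s X r \<omega>)"
    unfolding continuous_within
  proof (cases "t < s")
    case True
    have "\<forall>\<^sub>F r in at_right t. incr s X r \<omega> = incr s X t \<omega>"
      using True unfolding eventually_at_right_field
      by (intro exI[of _ s]) (auto simp: incr_def)
    then show "((\<lambda>r. incr s X r \<omega>) \<longlongrightarrow> incr s X t \<omega>) (at_right t)"
      by (rule tendsto_eventually)
  next
    case False
    have "\<forall>\<^sub>F r in at_right t. X r \<omega> - X s \<omega> = incr s X r \<omega>"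
      using False unfolding eventually_at_right_field
      by (intro exI[of _ "t + 1"]) (auto simp: incr_def)
    moreover have "((\<lambda>r. X r \<omega> - X s \<omega>) \<longlongrightarrow> X t \<omega> - X s \<omega>) (at_right t)"
      by (intro tendsto_intros c)
    ultimately show "((\<lambda>r. incr s X r \<omega>) \<longlongrightarrow> incr s X t \<omega>) (at_right t)"
      using False by (simp add: incr_eq Lim_transform_eventually)
  qed
  obtain l where l: "((\<lambda>r. X r \<omega>) \<longlongrightarrow> l) (at_left t)"
    using X \<omega> unfolding cadlag_process_def by blast
  show "\<exists>l. ((\<lambda>r. incr s X r \<omega>) \<longlongrightarrow> l) (at_left t)"
  proof (cases "s < t")
    case True
    have "\<forall>\<^sub>F r in at_left t. X r \<omega> - X s \<omega> = incr s X r \<omega>"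
      using True unfolding eventually_at_left_field
      by (intro exI[of _ s]) (auto simp: incr_def)
    moreover have "((\<lambda>r. X r \<omega> - X s \<omega>) \<longlongrightarrow> l - X s \<omega>) (at_left t)"
      by (intro tendsto_intros l)
    ultimately show ?thesis by (blast intro: Lim_transform_eventually)
  next
    case False
    have "\<forall>\<^sub>F r in at_left t. incr s X r \<omega> = 0"
      using False unfolding eventually_at_left_field
      by (intro exI[of _ "t - 1"]) (auto simp: incr_def)
    then show ?thesis by (blast intro: tendsto_eventually)
  qed
qed

lemma cadlag_process_diff_const_path:
  assumes X: "cadlag_process P X" and Z: "Z \<in> borel_measurable P"
  shows "cadlag_process P (\<lambda>t \<omega>. X t \<omega> - Z \<omega>)"
  unfolding cadlag_process_def
proof (intro conjI allI ballI)
  show "(\<lambda>\<omega>. X t \<omega> - Z \<omega>) \<in> borel_measurable P" for t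
    using X Z by (intro borel_measurable_diff) (auto simp: cadlag_process_def)
  fix \<omega> t assume "\<omega> \<in> space P"
  then have c: "continuous (at_right t) (\<lambda>r. X r \<omega>)" and "\<exists>l. ((\<lambda>r. X r \<omega>) \<longlongrightarrow> l) (at_left t)"
    using X unfolding cadlag_process_def by blast+
  then obtain l where "((\<lambda>r. X r \<omega>) \<longlongrightarrow> l) (at_left t)" by blast
  then have "((\<lambda>r. X r \<omega> - Z \<omega>) \<longlongrightarrow> l - Z \<omega>) (at_left t)"
    by (intro tendsto_intros)
  then show "\<exists>l. ((\<lambda>r. X r \<omega> - Z \<omega>) \<longlongrightarrow> l) (at_left t)" ..
  show "continuous (at_right t) (\<lambda>r. X r \<omega> - Z \<omega>)"
    using c by (intro continuous_intros)
qed

subsection \<open>Martingales indexed by the reals\<close>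

context complete_filtered_prob_space
begin

lemma sigma_finite_subalgebra_F: "sigma_finite_subalgebra P (F t)"
proof -
  interpret finite_measure_subalgebra P "F t"
    by unfold_locales (rule subalgebra_F)
  show ?thesis by (rule sigma_finite_subalgebra_axioms)
qed

lemma space_F_eq: "space (F t) = space P"
  using subalgebra_F[of t] by (simp add: subalgebra_def)

lemma measurable_F_imp_measurable: "f \<in> borel_measurable (F t) \<Longrightarrow> f \<in> borel_measurable P"
  by (rule measurable_from_subalg[OF subalgebra_F])

lemma measurable_F_mono:
  assumes "f \<in> borel_measurable (F s)" "s \<le> t"
  shows "f \<in> borel_measurable (F t)"
proof -
  have "subalgebra (F t) (F s)"
    using sets_F_mono[OF assms(2)] by (simp add: subalgebra_def space_F_eq)
  then show ?thesis
    using assms(1) by (rule measurable_from_subalg)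
qed

text \<open>The preimages under \<open>f\<close> and \<open>g\<close> differ only inside a null set
  \<open>N\<close>. By completeness every subset of \<open>N\<close> is a null set, and
  \<open>F t\<close> contains all null sets. Almost sure limits of \<open>F t\<close>-measurable
  functions thus stay \<open>F t\<close>-measurable.\<close>

lemma measurable_F_AE_cong:
  assumes g: "g \<in> borel_measurable (F t)" and ae: "AE \<omega> in P. f \<omega> = g \<omega>"
  shows "f \<in> borel_measurable (F t)"
proof (rule measurableI)
  show "f \<omega> \<in> space borel" for \<omega> by simp
  fix A :: "'b set" assume A: "A \<in> sets borel"
  from ae obtain N where N: "N \<in> null_sets P" "{\<omega> \<in> space P. f \<omega> \<noteq> g \<omega>} \<subseteq> N"
    by (auto simp: eventually_ae_filter)
  have "f -` A \<inter> space (F t) \<inter> N \<in> null_sets P"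
    using N(1) complete2[of "f -` A \<inter> space (F t) \<inter> N" N] by auto
  then have "f -` A \<inter> space (F t) \<inter> N \<in> sets (F t)" "N \<in> sets (F t)"
    using null_sets_F N(1) by auto
  then have "(g -` A \<inter> space (F t) - N) \<union> (f -` A \<inter> space (F t) \<inter> N) \<in> sets (F t)"
    using measurable_sets[OF g A] by auto
  also have "(g -` A \<inter> space (F t) - N) \<union> (f -` A \<inter> space (F t) \<inter> N) = f -` A \<inter> space (F t)"
    using N(2) by (auto simp: space_F_eq)
  finally show "f -` A \<inter> space (F t) \<in> sets (F t)" .
qed

section \<open>Bounded test functions, Doob's maximal inequality, and convergence at minus
  infinity\<close>

lemma martingalesD:
  assumes "X \<in> martingales P F"
  shows "cadlag_process P X" "X t \<in> borel_measurable (F t)" "integrable P (X t)"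
    "s < t \<Longrightarrow> AE \<omega> in P. real_cond_exp P (F s) (X t) \<omega> = X s \<omega>"
    "X t \<in> borel_measurable P"
  using assms measurable_F_imp_measurable by (auto simp: martingales_def)

text \<open>The martingale property in integrated form: a bounded \<open>F s\<close>-measurable
  factor passes through the conditional expectation given \<open>F s\<close>. The test functions
  used later are signs times indicators, and \<open>clip l (X s)\<close>.\<close>

lemma martingale_mult_bounded:
  assumes X: "X \<in> martingales P F" and st: "s \<le> t"
    and g: "g \<in> borel_measurable (F s)" and B: "\<And>\<omega>. \<bar>g \<omega>\<bar> \<le> B"
  shows "integrable P (\<lambda>\<omega>. g \<omega> * X t \<omega>)"
    and "(\<integral>\<omega>. g \<omega> * X t \<omega> \<partial>P) = (\<integral>\<omega>. g \<omega> * X s \<omega> \<partial>P)"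
proof -
  have gP [measurable]: "g \<in> borel_measurable P"
    using g by (rule measurable_F_imp_measurable)
  have [measurable]: "X t \<in> borel_measurable P" for t
    using martingalesD(5)[OF X] .
  have int: "integrable P (\<lambda>\<omega>. g \<omega> * X t \<omega>)" for t
  proof (rule Bochner_Integration.integrable_bound[where f="\<lambda>\<omega>. B * X t \<omega>"])
    have "\<bar>g \<omega>\<bar> * \<bar>X t \<omega>\<bar> \<le> \<bar>B\<bar> * \<bar>X t \<omega>\<bar>" for \<omega>
      using B[of \<omega>] by (intro mult_right_mono) auto
    then show "AE \<omega> in P. norm (g \<omega> * X t \<omega>) \<le> norm (B * X t \<omega>)"
      by (auto simp: abs_mult)
  qed (auto intro: martingalesD(3)[OF X])
  show "integrable P (\<lambda>\<omega>. g \<omega> * X t \<omega>)" by (rule int)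
  show "(\<integral>\<omega>. g \<omega> * X t \<omega> \<partial>P) = (\<integral>\<omega>. g \<omega> * X s \<omega> \<partial>P)"
  proof (cases "s = t")
    case False
    with st have "s < t" by simp
    interpret sigma_finite_subalgebra P "F s" by (rule sigma_finite_subalgebra_F)
    have "(\<integral>\<omega>. g \<omega> * X t \<omega> \<partial>P) = (\<integral>\<omega>. g \<omega> * real_cond_exp P (F s) (X t) \<omega> \<partial>P)"
      using int g by (intro real_cond_exp_intg(2)[symmetric]) auto
    also have "\<dots> = (\<integral>\<omega>. g \<omega> * X s \<omega> \<partial>P)"
      using martingalesD(4)[OF X \<open>s < t\<close>] by (intro integral_cong_AE) auto
    finally show ?thesis .
  qed simp
qed

text \<open>The submartingale property of \<open>|X|\<close>. Testing against the sign of
  \<open>X s\<close> on \<open>A\<close> turns \<open>|X s|\<close> into \<open>X s\<close>, which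
  may be replaced by \<open>X t\<close>; the product is then at most \<open>|X t|\<close> on
  \<open>A\<close>.\<close>

lemma martingale_abs_set_integral_mono:
  assumes X: "X \<in> martingales P F" and st: "s \<le> t" and A: "A \<in> sets (F s)"
  shows "(\<integral>\<omega>. \<bar>X s \<omega>\<bar> * indicator A \<omega> \<partial>P) \<le> (\<integral>\<omega>. \<bar>X t \<omega>\<bar> * indicator A \<omega> \<partial>P)"
proof -
  define g where "g \<omega> = sgn (X s \<omega>) * indicator A \<omega>" for \<omega>
  have [measurable]: "X s \<in> borel_measurable (F s)" using martingalesD(2)[OF X] .
  have g: "g \<in> borel_measurable (F s)"
    unfolding g_def using A by measurable
  have bd: "\<bar>g \<omega>\<bar> \<le> 1" for \<omega>
    by (auto simp: g_def sgn_if indicator_def)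
  have AP: "A \<in> sets P" using A subalgebra_F by (auto simp: subalgebra_def)
  have "(\<integral>\<omega>. \<bar>X s \<omega>\<bar> * indicator A \<omega> \<partial>P) = (\<integral>\<omega>. g \<omega> * X s \<omega> \<partial>P)"
    by (intro Bochner_Integration.integral_cong) (auto simp: g_def abs_sgn algebra_simps)
  also have "\<dots> = (\<integral>\<omega>. g \<omega> * X t \<omega> \<partial>P)"
    using martingale_mult_bounded(2)[OF X st g bd] by simp
  also have "\<dots> \<le> (\<integral>\<omega>. \<bar>X t \<omega>\<bar> * indicator A \<omega> \<partial>P)"
  proof (rule integral_mono)
    show "integrable P (\<lambda>\<omega>. g \<omega> * X t \<omega>)"
      using martingale_mult_bounded(1)[OF X st g bd] .
    show "integrable P (\<lambda>\<omega>. \<bar>X t \<omega>\<bar> * indicator A \<omega>)"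
      using AP martingalesD(3)[OF X, of t] by (intro integrable_real_mult_indicator) auto
    show "g \<omega> * X t \<omega> \<le> \<bar>X t \<omega>\<bar> * indicator A \<omega>" for \<omega>
      by (auto simp: g_def sgn_if indicator_def)
  qed
  finally show ?thesis .
qed

text \<open>Doob's maximal inequality by induction on the largest time \<open>b\<close>. The event
  splits into the one for the earlier times, where the induction hypothesis is used with
  \<open>T = b\<close>, and the part where only \<open>|X b|\<close> exceeds \<open>l\<close>.
  Keeping the event in the right-hand integral lets the two parts be added before passing from
  \<open>b\<close> to \<open>T\<close>.\<close>

lemma martingale_maximal_finite:
  assumes X: "X \<in> martingales P F" and "finite S" and "\<And>t. t \<in> S \<Longrightarrow> t \<le> T" and "0 \<le> l"
  shows "l * prob {\<omega>\<in>space P. \<exists>t\<in>S. l < \<bar>X t \<omega>\<bar>}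
           \<le> (\<integral>\<omega>. \<bar>X T \<omega>\<bar> * indicator {\<omega>\<in>space P. \<exists>t\<in>S. l < \<bar>X t \<omega>\<bar>} \<omega> \<partial>P)"
  using assms(2,3)
proof (induction S arbitrary: T rule: finite_linorder_max_induct)
  case empty
  then show ?case by simp
next
  case (insert b S)
  define A where "A S = {\<omega>\<in>space P. \<exists>t\<in>S. l < \<bar>X t \<omega>\<bar>}" for S
  have meas: "A S' \<in> sets (F b)" if "finite S'" "\<And>t. t \<in> S' \<Longrightarrow> t \<le> b" for S'
  proof -
    have "A S' = (\<Union>t\<in>S'. {\<omega>\<in>space (F b). l < \<bar>X t \<omega>\<bar>})"
      by (auto simp: A_def space_F_eq)
    also have "\<dots> \<in> sets (F b)"
    proof (intro sets.finite_UN that(1))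
      fix t assume "t \<in> S'"
      then have [measurable]: "X t \<in> borel_measurable (F b)"
        using that(2) martingalesD(2)[OF X] measurable_F_mono by blast
      show "{\<omega>\<in>space (F b). l < \<bar>X t \<omega>\<bar>} \<in> sets (F b)" by measurable
    qed
    finally show ?thesis .
  qed
  let ?S = "insert b S"
  have AS: "A S \<in> sets (F b)" and AI: "A ?S \<in> sets (F b)"
    using insert.hyps by (auto intro!: meas intro: less_imp_le)
  have FP: "B \<in> sets (F b) \<Longrightarrow> B \<in> sets P" for B
    using subalgebra_F by (auto simp: subalgebra_def)
  have intA: "integrable P (\<lambda>\<omega>. \<bar>X b \<omega>\<bar> * indicator B \<omega>)" if "B \<in> sets (F b)" for B
    using FP[OF that] martingalesD(3)[OF X, of b] by (intro integrable_real_mult_indicator) auto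
  have sub: "A S \<subseteq> A ?S" by (auto simp: A_def)
  have D: "A ?S - A S \<in> sets (F b)" using AS AI by auto
  have "l * prob (A ?S) = l * prob (A S) + l * prob (A ?S - A S)"
    using finite_measure_Diff[OF FP[OF AI] FP[OF AS] sub] by (simp flip: distrib_left)
  also have "\<dots> \<le> (\<integral>\<omega>. \<bar>X b \<omega>\<bar> * indicator (A S) \<omega> \<partial>P) + (\<integral>\<omega>. \<bar>X b \<omega>\<bar> * indicator (A ?S - A S) \<omega> \<partial>P)"
  proof (rule add_mono)
    show "l * prob (A S) \<le> (\<integral>\<omega>. \<bar>X b \<omega>\<bar> * indicator (A S) \<omega> \<partial>P)"
      unfolding A_def using insert.hyps by (intro insert.IH) auto
    have "(\<integral>\<omega>. l * indicator (A ?S - A S) \<omega> \<partial>P) \<le> (\<integral>\<omega>. \<bar>X b \<omega>\<bar> * indicator (A ?S - A S) \<omega> \<partial>P)"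
    proof (rule integral_mono)
      show "integrable P (\<lambda>\<omega>. l * indicator (A ?S - A S) \<omega>)"
        using FP[OF D] by (intro integrable_mult_right integrable_real_indicator) (auto simp: emeasure_eq_measure)
      show "l * indicator (A ?S - A S) \<omega> \<le> \<bar>X b \<omega>\<bar> * indicator (A ?S - A S) \<omega>" for \<omega>
        by (auto simp: A_def indicator_def)
    qed (rule intA[OF D])
    then show "l * prob (A ?S - A S) \<le> (\<integral>\<omega>. \<bar>X b \<omega>\<bar> * indicator (A ?S - A S) \<omega> \<partial>P)"
      using FP[OF D] by simp
  qed
  also have "\<dots> = (\<integral>\<omega>. \<bar>X b \<omega>\<bar> * indicator (A S) \<omega> + \<bar>X b \<omega>\<bar> * indicator (A ?S - A S) \<omega> \<partial>P)"
    by (rule Bochner_Integration.integral_add[symmetric]) (rule intA[OF AS] intA[OF D])+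
  also have "\<dots> = (\<integral>\<omega>. \<bar>X b \<omega>\<bar> * indicator (A ?S) \<omega> \<partial>P)"
    using sub by (intro Bochner_Integration.integral_cong) (auto simp: indicator_def)
  also have "\<dots> \<le> (\<integral>\<omega>. \<bar>X T \<omega>\<bar> * indicator (A ?S) \<omega> \<partial>P)"
    using insert.prems by (intro martingale_abs_set_integral_mono[OF X _ AI]) auto
  finally show ?case unfolding A_def .
qed

text \<open>Continuity of the measure from below, along the finite initial segments of an
  enumeration of \<open>S\<close>.\<close>

lemma martingale_maximal_countable:
  assumes X: "X \<in> martingales P F" and "countable S" and S: "\<And>t. t \<in> S \<Longrightarrow> t \<le> T" and l: "0 \<le> l"
  shows "l * prob {\<omega>\<in>space P. \<exists>t\<in>S. l < \<bar>X t \<omega>\<bar>} \<le> (\<integral>\<omega>. \<bar>X T \<omega>\<bar> \<partial>P)"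
proof (cases "S = {}")
  case False
  define e where "e = from_nat_into S"
  have e: "range e = S" unfolding e_def using False assms(2) by (rule range_from_nat_into)
  define A where "A n = {\<omega>\<in>space P. \<exists>t\<in>e ` {..n}. l < \<bar>X t \<omega>\<bar>}" for n :: nat
  have [measurable]: "X t \<in> borel_measurable P" for t
    using martingalesD(5)[OF X] .
  have A [measurable]: "A n \<in> sets P" for n
    unfolding A_def by measurable
  have un: "(\<Union>n. A n) = {\<omega>\<in>space P. \<exists>t\<in>S. l < \<bar>X t \<omega>\<bar>}"
    unfolding A_def e[symmetric] by auto
  have "incseq A" by (force simp: incseq_def A_def)
  then have "(\<lambda>n. prob (A n)) \<longlonglongrightarrow> prob (\<Union>n. A n)"
    using A by (intro finite_Lim_measure_incseq) auto
  then have "(\<lambda>n. l * prob (A n)) \<longlonglongrightarrow> l * prob (\<Union>n. A n)"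
    by (intro tendsto_intros)
  moreover have "l * prob (A n) \<le> (\<integral>\<omega>. \<bar>X T \<omega>\<bar> \<partial>P)" for n
  proof -
    have "l * prob (A n) \<le> (\<integral>\<omega>. \<bar>X T \<omega>\<bar> * indicator (A n) \<omega> \<partial>P)"
      unfolding A_def using e S l by (intro martingale_maximal_finite[OF X]) auto
    also have "\<dots> \<le> (\<integral>\<omega>. \<bar>X T \<omega>\<bar> \<partial>P)"
      using martingalesD(3)[OF X, of T] A
      by (intro integral_mono integrable_real_mult_indicator) (auto simp: indicator_def)
    finally show ?thesis .
  qed
  ultimately show ?thesis
    unfolding un by (intro LIMSEQ_le_const2) auto
qed simp

text \<open>The maximal inequality with final time \<open>-k\<close> bounds the probability that
  \<open>|X|\<close> exceeds \<open>1 / (m + 1)\<close> at some rational time up to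
  \<open>-k\<close> by \<open>(m + 1) * E |X (-k)|\<close>, which tends to 0. So almost surely this
  fails for some \<open>k\<close>; right-continuity then covers the other times.\<close>

lemma martingale_AE_tendsto_0_at_bot:
  assumes X: "X \<in> martingales P F"
    and lim: "((\<lambda>t. \<integral>\<omega>. \<bar>X t \<omega>\<bar> \<partial>P) \<longlongrightarrow> 0) at_bot"
  shows "AE \<omega> in P. ((\<lambda>t. X t \<omega>) \<longlongrightarrow> 0) at_bot"
proof -
  have [measurable]: "X t \<in> borel_measurable P" for t
    using martingalesD(5)[OF X] .
  have "AE \<omega> in P. \<exists>k::nat. \<forall>t\<in>\<rat>. t \<le> - real k \<longrightarrow> \<bar>X t \<omega>\<bar> \<le> 1 / Suc m" for m :: nat
  proof -
    let ?l = "1 / real (Suc m)"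
    define B where "B k = {\<omega>\<in>space P. \<exists>t\<in>\<rat> \<inter> {..- real k}. ?l < \<bar>X t \<omega>\<bar>}" for k :: nat
    have cnt: "countable (\<rat> \<inter> {..- real k})" for k
      by (simp add: countable_rat)
    have B [measurable]: "B k \<in> sets P" for k
    proof -
      have "B k = (\<Union>t\<in>\<rat> \<inter> {..- real k}. {\<omega>\<in>space P. ?l < \<bar>X t \<omega>\<bar>})"
        by (auto simp: B_def)
      also have "\<dots> \<in> sets P"
        by (intro sets.countable_UN'' cnt) measurable
      finally show ?thesis .
    qed
    have "filterlim (\<lambda>k. - real k) at_bot sequentially"
      by (simp add: filterlim_uminus_at_bot filterlim_real_sequentially)
    from filterlim_compose[OF lim this]
    have lim0: "(\<lambda>k. real (Suc m) * (\<integral>\<omega>. \<bar>X (- real k) \<omega>\<bar> \<partial>P)) \<longlonglongrightarrow> 0"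
      by (rule tendsto_mult_right_zero)
    have "prob (\<Inter>k. B k) \<le> real (Suc m) * (\<integral>\<omega>. \<bar>X (- real k) \<omega>\<bar> \<partial>P)" for k
    proof -
      have "prob (\<Inter>k. B k) \<le> prob (B k)"
        by (intro finite_measure_mono) auto
      moreover have "?l * prob (B k) \<le> (\<integral>\<omega>. \<bar>X (- real k) \<omega>\<bar> \<partial>P)"
        unfolding B_def by (intro martingale_maximal_countable[OF X cnt]) auto
      then have "prob (B k) \<le> real (Suc m) * (\<integral>\<omega>. \<bar>X (- real k) \<omega>\<bar> \<partial>P)"
        by (simp add: field_simps)
      ultimately show ?thesis by simp
    qed
    then have "prob (\<Inter>k. B k) \<le> 0"
      by (intro LIMSEQ_le_const[OF lim0]) auto
    then have "prob (\<Inter>k. B k) = 0"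
      by (simp add: antisym)
    then have "(\<Inter>k. B k) \<in> null_sets P"
      using B by (simp add: null_sets_def emeasure_eq_measure)
    then have "AE \<omega> in P. \<omega> \<notin> (\<Inter>k. B k)" by (rule AE_not_in)
    then show ?thesis
      by (rule AE_mp) (rule AE_I2, force simp: B_def not_less)
  qed
  then have "AE \<omega> in P. \<forall>m::nat. \<exists>k::nat. \<forall>t\<in>\<rat>. t \<le> - real k \<longrightarrow> \<bar>X t \<omega>\<bar> \<le> 1 / Suc m"
    unfolding AE_all_countable by blast
  moreover have "((\<lambda>t. X t \<omega>) \<longlongrightarrow> 0) at_bot"
    if \<omega>: "\<omega> \<in> space P"
      and *: "\<forall>m::nat. \<exists>k::nat. \<forall>t\<in>\<rat>. t \<le> - real k \<longrightarrow> \<bar>X t \<omega>\<bar> \<le> 1 / Suc m" for \<omega>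
  proof (rule tendstoI)
    fix e :: real assume "0 < e"
    then obtain m :: nat where m: "1 / Suc m < e"
      using nat_approx_posE by metis
    from * obtain k :: nat where k: "\<And>t. t \<in> \<rat> \<Longrightarrow> t \<le> - real k \<Longrightarrow> \<bar>X t \<omega>\<bar> \<le> 1 / Suc m" by blast
    \<comment> \<open>A violation at \<open>t\<close> would persist on an interval to the right of
      \<open>t\<close>. As \<open>t\<close> lies strictly below \<open>- k\<close>, that interval
      contains a rational below \<open>- k\<close>.\<close>
    have "\<bar>X t \<omega>\<bar> \<le> 1 / Suc m" if "t < - real k" for t
    proof (rule ccontr)
      assume c: "\<not> ?thesis"
      have "continuous (at_right t) (\<lambda>s. X s \<omega>)"
        using martingalesD(1)[OF X] \<omega> by (auto simp: cadlag_process_def)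
      then have "((\<lambda>s. \<bar>X s \<omega>\<bar>) \<longlongrightarrow> \<bar>X t \<omega>\<bar>) (at_right t)"
        unfolding continuous_within by (rule tendsto_rabs)
      then have "\<forall>\<^sub>F s in at_right t. 1 / Suc m < \<bar>X s \<omega>\<bar>"
        using c by (intro order_tendstoD(1)) auto
      then obtain b where b: "b > t" "\<And>s. t < s \<Longrightarrow> s < b \<Longrightarrow> 1 / Suc m < \<bar>X s \<omega>\<bar>"
        unfolding eventually_at_right_field by auto
      have "t < min b (- real k)" using b(1) \<open>t < - real k\<close> by simp
      from Rats_dense_in_real[OF this]
      obtain q where q: "q \<in> \<rat>" "t < q" "q < min b (- real k)" by blast
      show False using b(2)[of q] k[of q] q by auto
    qed
    then have "\<bar>X t \<omega>\<bar> < e" if "t < - real k" for t using m that by fastforce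
    then show "\<forall>\<^sub>F t in at_bot. dist (X t \<omega>) 0 < e"
      unfolding eventually_at_bot_dense by auto
  qed
  ultimately show ?thesis by (auto elim: AE_mp)
qed

subsection \<open>Increment martingales\<close>

text \<open>The linear term has expectation 0, because \<open>clip l (X s)\<close> is a bounded
  \<open>F s\<close>-measurable factor of the increment.\<close>

lemma martingale_huber_gap:
  assumes X: "X \<in> martingales P F" and st: "s \<le> t" and l: "0 \<le> l"
  shows "integrable P (\<lambda>\<omega>. huber_gap l (X s \<omega>) (X t \<omega>))"
    and "(\<integral>\<omega>. huber_gap l (X s \<omega>) (X t \<omega>) \<partial>P)
           = (\<integral>\<omega>. huber l (X t \<omega>) \<partial>P) - (\<integral>\<omega>. huber l (X s \<omega>) \<partial>P)"
proof -
  have [measurable]: "X t \<in> borel_measurable P" "X s \<in> borel_measurable (F s)" for t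
    using martingalesD(2,5)[OF X] by auto
  have hub: "integrable P (\<lambda>\<omega>. huber l (X t \<omega>))" for t
    using integrable_huber[OF l martingalesD(3)[OF X]] .
  have g: "(\<lambda>\<omega>. clip l (X s \<omega>)) \<in> borel_measurable (F s)" by measurable
  have bd: "\<bar>clip l (X s \<omega>)\<bar> \<le> l" for \<omega> using abs_clip_le l by auto
  note m = martingale_mult_bounded[OF X _ g bd]
  have eq: "huber_gap l (X s \<omega>) (X t \<omega>) =
      huber l (X t \<omega>) - huber l (X s \<omega>) - 2 * (clip l (X s \<omega>) * X t \<omega> - clip l (X s \<omega>) * X s \<omega>)" for \<omega>
    by (simp add: huber_gap_def algebra_simps)
  show "integrable P (\<lambda>\<omega>. huber_gap l (X s \<omega>) (X t \<omega>))"
    unfolding eq using hub m(1)[OF st] m(1)[OF order_refl] by simp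
  show "(\<integral>\<omega>. huber_gap l (X s \<omega>) (X t \<omega>) \<partial>P)
          = (\<integral>\<omega>. huber l (X t \<omega>) \<partial>P) - (\<integral>\<omega>. huber l (X s \<omega>) \<partial>P)"
    unfolding eq using hub m(1)[OF st] m(1)[OF order_refl] m(2)[OF st] by simp
qed

lemma martingale_huber_mono:
  assumes "X \<in> martingales P F" "s \<le> t" "0 \<le> l"
  shows "(\<integral>\<omega>. huber l (X s \<omega>) \<partial>P) \<le> (\<integral>\<omega>. huber l (X t \<omega>) \<partial>P)"
proof -
  have "0 \<le> (\<integral>\<omega>. huber_gap l (X s \<omega>) (X t \<omega>) \<partial>P)"
    using huber_gap_nonneg[OF assms(3)] by (intro Bochner_Integration.integral_nonneg) auto
  then show ?thesis using martingale_huber_gap(2)[OF assms] by simp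
qed

text \<open>Where both values lie in \<open>[-l, l]\<close>, the gap is the square of the increment
  \<open>d\<close>, and \<open>|d| \<le> a + d\<^sup>2 / (4 * a)\<close> follows from
  \<open>(|d| - 2 * a)\<^sup>2 \<ge> 0\<close>. Elsewhere \<open>Y\<close> dominates. The number
  \<open>a\<close> is left free to balance the terms.\<close>

lemma martingale_L1_increment:
  assumes X: "X \<in> martingales P F" and st: "s \<le> t" and l: "0 < l" and a: "0 < a"
    and Y: "integrable P Y"
    and le: "\<And>\<omega>. l < \<bar>X s \<omega>\<bar> \<or> l < \<bar>X t \<omega>\<bar> \<Longrightarrow> \<bar>X t \<omega> - X s \<omega>\<bar> \<le> Y \<omega>" and Y0: "\<And>\<omega>. 0 \<le> Y \<omega>"
  shows "(\<integral>\<omega>. \<bar>X t \<omega> - X s \<omega>\<bar> \<partial>P)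
           \<le> a + ((\<integral>\<omega>. huber l (X t \<omega>) \<partial>P) - (\<integral>\<omega>. huber l (X s \<omega>) \<partial>P)) / (4 * a) + (\<integral>\<omega>. Y \<omega> \<partial>P)"
proof -
  let ?r = "\<lambda>\<omega>. huber_gap l (X s \<omega>) (X t \<omega>)"
  have l0: "0 \<le> l" using l by simp
  note r = martingale_huber_gap[OF X st l0]
  have "(\<integral>\<omega>. \<bar>X t \<omega> - X s \<omega>\<bar> \<partial>P) \<le> (\<integral>\<omega>. a + ?r \<omega> / (4 * a) + Y \<omega> \<partial>P)"
  proof (rule integral_mono)
    show "integrable P (\<lambda>\<omega>. \<bar>X t \<omega> - X s \<omega>\<bar>)"
      using martingalesD(3)[OF X] by auto
    show "integrable P (\<lambda>\<omega>. a + ?r \<omega> / (4 * a) + Y \<omega>)"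
      using r(1) Y by auto
    fix \<omega>
    let ?d = "X t \<omega> - X s \<omega>"
    have gap0: "0 \<le> ?r \<omega> / (4 * a)"
      using huber_gap_nonneg[OF l0] a by simp
    show "\<bar>?d\<bar> \<le> a + ?r \<omega> / (4 * a) + Y \<omega>"
    proof (cases "\<bar>X s \<omega>\<bar> \<le> l \<and> \<bar>X t \<omega>\<bar> \<le> l")
      case True
      have "0 \<le> (\<bar>?d\<bar> - 2 * a)\<^sup>2" by simp
      then have "\<bar>?d\<bar> * (4 * a) \<le> a * (4 * a) + \<bar>?d\<bar>\<^sup>2"
        by (simp add: power2_eq_square algebra_simps)
      then have "\<bar>?d\<bar> \<le> a + ?d\<^sup>2 / (4 * a)"
        using a by (simp add: field_simps)
      also have "\<dots> = a + ?r \<omega> / (4 * a)"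
        using True by (simp add: huber_gap_eq)
      finally show ?thesis using Y0[of \<omega>] by simp
    next
      case False
      then have "\<bar>?d\<bar> \<le> Y \<omega>" by (intro le) auto
      then show ?thesis using a gap0 by linarith
    qed
  qed
  also have "\<dots> = a + (\<integral>\<omega>. ?r \<omega> \<partial>P) / (4 * a) + (\<integral>\<omega>. Y \<omega> \<partial>P)"
    using r(1) Y by (simp add: prob_space)
  finally show ?thesis by (simp add: r(2))
qed

section \<open>Convergence of increment martingales at minus infinity\<close>

lemma increment_martingalesD:
  assumes "M \<in> increment_martingales P F"
  shows "cadlag_process P M" "incr s M \<in> martingales P F" "M t \<in> borel_measurable P"
  using assms by (auto simp: increment_martingales_def cadlag_process_def)

lemma integrable_increment:
  assumes "M \<in> increment_martingales P F"
  shows "integrable P (\<lambda>\<omega>. M t \<omega> - M s \<omega>)"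
proof -
  have *: "integrable P (\<lambda>\<omega>. M t \<omega> - M s \<omega>)" if "s \<le> t" for s t
    using martingalesD(3)[OF increment_martingalesD(2)[OF assms], of s t] that by (simp add: incr_eq)
  show ?thesis
  proof (cases "s \<le> t")
    case False
    then have "integrable P (\<lambda>\<omega>. - (M s \<omega> - M t \<omega>))"
      by (intro Bochner_Integration.integrable_minus *) auto
    then show ?thesis by simp
  qed (rule *)
qed

text \<open>By contradiction, with a chain of \<open>n\<close> intervals of large increment. The
  base point \<open>u\<close> must lie to the left of the whole chain and so depends on
  \<open>n\<close>; the argument works because both the gain per interval and the bound on
  \<open>h u\<close> are uniform in \<open>u\<close>.\<close>

lemma L1_Cauchy_at_bot:
  assumes M: "M \<in> increment_martingales P F"
    and ui: "\<And>e. 0 < e \<Longrightarrow> \<exists>c>0. \<forall>s<0. (\<integral>\<omega>. tail c (M 0 \<omega> - M s \<omega>) \<partial>P) \<le> e"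
    and e: "0 < e"
  shows "\<exists>T<0. \<forall>s t. s \<le> t \<longrightarrow> t \<le> T \<longrightarrow> (\<integral>\<omega>. \<bar>M t \<omega> - M s \<omega>\<bar> \<partial>P) \<le> e"
proof (rule ccontr)
  assume "\<not> ?thesis"
  then have bad: "\<exists>s t. s \<le> t \<and> t \<le> T \<and> e < (\<integral>\<omega>. \<bar>M t \<omega> - M s \<omega>\<bar> \<partial>P)" if "T < 0" for T
    using that by (auto simp: not_le)
  note int [simp] = integrable_increment[OF M]
  obtain c0 where c0: "0 < c0" "\<And>s. s < 0 \<Longrightarrow> (\<integral>\<omega>. tail c0 (M 0 \<omega> - M s \<omega>) \<partial>P) \<le> 1"
    using ui[of 1] by auto
  obtain c where c: "0 < c" "\<And>s. s < 0 \<Longrightarrow> (\<integral>\<omega>. tail c (M 0 \<omega> - M s \<omega>) \<partial>P) \<le> e / 16"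
    using ui[of "e / 16"] e by auto
  define C where "C = c0 + 1"
  have C: "0 < C" using c0 by (simp add: C_def)
  have D: "(\<integral>\<omega>. \<bar>M 0 \<omega> - M s \<omega>\<bar> \<partial>P) \<le> C" if "s < 0" for s
  proof -
    have "(\<integral>\<omega>. \<bar>M 0 \<omega> - M s \<omega>\<bar> \<partial>P) \<le> (\<integral>\<omega>. c0 + tail c0 (M 0 \<omega> - M s \<omega>) \<partial>P)"
      using c0(1) by (intro integral_mono abs_le_add_tail) (auto intro!: integrable_tail)
    also have "\<dots> = c0 + (\<integral>\<omega>. tail c0 (M 0 \<omega> - M s \<omega>) \<partial>P)"
      by (subst Bochner_Integration.integral_add) (auto intro!: integrable_tail simp: prob_space)
    also have "\<dots> \<le> C" using c0(2)[OF that] by (simp add: C_def)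
    finally show ?thesis .
  qed
  have f: "(\<integral>\<omega>. \<bar>M t \<omega> - M u \<omega>\<bar> \<partial>P) \<le> 2 * C" if "u < 0" "t < 0" for u t
  proof -
    have "(\<integral>\<omega>. \<bar>M t \<omega> - M u \<omega>\<bar> \<partial>P) \<le> (\<integral>\<omega>. \<bar>M 0 \<omega> - M u \<omega>\<bar> + \<bar>M 0 \<omega> - M t \<omega>\<bar> \<partial>P)"
      by (intro integral_mono) auto
    also have "\<dots> \<le> 2 * C" using D[OF that(1)] D[OF that(2)] by simp
    finally show ?thesis .
  qed
  \<comment> \<open>Chosen so that \<open>2 * c / l * (2 * C + 2 * C) = e / 8\<close>; together with
    two tails of at most \<open>e / 16\<close> each, this gives \<open>e / 4\<close> for the
    integral of \<open>Y\<close> below.\<close>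
  define l where "l = 64 * c * C / e"
  have l: "0 < l" using c(1) C e by (simp add: l_def)
  define h where "h u t = (\<integral>\<omega>. huber l (M t \<omega> - M u \<omega>) \<partial>P)" for u t
  have inthub: "integrable P (\<lambda>\<omega>. huber l (M t \<omega> - M u \<omega>))" for t u
    using l by (intro integrable_huber int) auto
  have h_bound: "h u t \<le> 4 * l * C" if "u < 0" "t < 0" for u t
  proof -
    have "h u t \<le> (\<integral>\<omega>. 2 * l * \<bar>M t \<omega> - M u \<omega>\<bar> \<partial>P)"
      unfolding h_def using inthub l by (intro integral_mono huber_le) auto
    also have "\<dots> = 2 * l * (\<integral>\<omega>. \<bar>M t \<omega> - M u \<omega>\<bar> \<partial>P)" by simp
    also have "\<dots> \<le> 2 * l * (2 * C)" using f[OF that] l by (intro mult_left_mono) auto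
    finally show ?thesis by simp
  qed
  have incrX: "incr u M t = (\<lambda>\<omega>. M t \<omega> - M u \<omega>)" if "u \<le> t" for u t
    using that by (rule incr_eq)
  \<comment> \<open>The constant \<open>3 * e / 8\<close> is \<open>e / 8\<close> for the free
    parameter \<open>a\<close> plus \<open>e / 4\<close> for \<open>Y\<close>. It is below
    \<open>e\<close>, so an increment of \<open>L\<^sup>1\<close>-norm above \<open>e\<close> raises
    \<open>h u\<close> by more than \<open>5 * e\<^sup>2 / 16\<close>.\<close>
  have step: "(\<integral>\<omega>. \<bar>M t \<omega> - M s \<omega>\<bar> \<partial>P) \<le> 3 * e / 8 + (h u t - h u s) / (e / 2)"
    if "u \<le> s" "s \<le> t" "t < 0" for u s t
  proof -
    \<comment> \<open>Comparing both times with time 0 gives \<open>|M t - M s| \<le> 2 * c\<close>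
      plus two tails. Where a value exceeds \<open>l\<close>, the first summand of \<open>Y\<close>
      is at least \<open>2 * c\<close>.\<close>
    define Y where "Y \<omega> = 2 * c / l * (\<bar>M s \<omega> - M u \<omega>\<bar> + \<bar>M t \<omega> - M u \<omega>\<bar>)
        + (tail c (M 0 \<omega> - M s \<omega>) + tail c (M 0 \<omega> - M t \<omega>))" for \<omega>
    have Yint: "integrable P Y"
      unfolding Y_def by (intro Bochner_Integration.integrable_add integrable_mult_right integrable_tail
          integrable_abs int)
    have "(\<integral>\<omega>. Y \<omega> \<partial>P) = 2 * c / l * ((\<integral>\<omega>. \<bar>M s \<omega> - M u \<omega>\<bar> \<partial>P) + (\<integral>\<omega>. \<bar>M t \<omega> - M u \<omega>\<bar> \<partial>P))
        + ((\<integral>\<omega>. tail c (M 0 \<omega> - M s \<omega>) \<partial>P) + (\<integral>\<omega>. tail c (M 0 \<omega> - M t \<omega>) \<partial>P))"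
      unfolding Y_def by (simp add: integrable_tail)
    also have "\<dots> \<le> 2 * c / l * (2 * C + 2 * C) + (e / 16 + e / 16)"
      using that c l by (intro add_mono mult_left_mono f c(2)) auto
    also have "\<dots> = e / 4"
      using c(1) C e by (simp add: l_def field_simps)
    finally have IY: "(\<integral>\<omega>. Y \<omega> \<partial>P) \<le> e / 4" .
    have "(\<integral>\<omega>. \<bar>incr u M t \<omega> - incr u M s \<omega>\<bar> \<partial>P)
        \<le> e / 8 + ((\<integral>\<omega>. huber l (incr u M t \<omega>) \<partial>P) - (\<integral>\<omega>. huber l (incr u M s \<omega>) \<partial>P)) / (4 * (e / 8)) + (\<integral>\<omega>. Y \<omega> \<partial>P)"
    proof (rule martingale_L1_increment[OF increment_martingalesD(2)[OF M] \<open>s \<le> t\<close> l _ Yint])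
      show "0 \<le> Y \<omega>" for \<omega>
        using c(1) l by (auto simp: Y_def intro!: add_nonneg_nonneg tail_nonneg)
      show "\<bar>incr u M t \<omega> - incr u M s \<omega>\<bar> \<le> Y \<omega>" if "l < \<bar>incr u M s \<omega>\<bar> \<or> l < \<bar>incr u M t \<omega>\<bar>" for \<omega>
      proof -
        have "l \<le> \<bar>M s \<omega> - M u \<omega>\<bar> + \<bar>M t \<omega> - M u \<omega>\<bar>"
          using that \<open>u \<le> s\<close> \<open>s \<le> t\<close> by (auto simp: incrX)
        then have "2 * c / l * l \<le> 2 * c / l * (\<bar>M s \<omega> - M u \<omega>\<bar> + \<bar>M t \<omega> - M u \<omega>\<bar>)"
          using c(1) l by (intro mult_left_mono) auto
        then have "2 * c \<le> 2 * c / l * (\<bar>M s \<omega> - M u \<omega>\<bar> + \<bar>M t \<omega> - M u \<omega>\<bar>)"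
          using l by simp
        moreover have "\<bar>M t \<omega> - M s \<omega>\<bar> \<le> \<bar>M 0 \<omega> - M s \<omega>\<bar> + \<bar>M 0 \<omega> - M t \<omega>\<bar>" by simp
        moreover have "\<bar>M 0 \<omega> - M s \<omega>\<bar> \<le> c + tail c (M 0 \<omega> - M s \<omega>)"
          "\<bar>M 0 \<omega> - M t \<omega>\<bar> \<le> c + tail c (M 0 \<omega> - M t \<omega>)"
          using c(1) by (auto intro: abs_le_add_tail)
        ultimately show ?thesis
          using \<open>u \<le> s\<close> \<open>s \<le> t\<close> unfolding Y_def by (simp add: incrX)
      qed
    qed (use e in simp)
    then show ?thesis
      using IY \<open>u \<le> s\<close> \<open>s \<le> t\<close> by (simp add: incrX h_def)
  qed
  have mono: "h u s \<le> h u t" if "u \<le> s" "s \<le> t" for u s t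
    using martingale_huber_mono[OF increment_martingalesD(2)[OF M, of u] that(2), of l] that l
    by (simp add: incrX h_def)
  \<comment> \<open>The chain grows from right to left: a bad interval \<open>[s, t]\<close> below
    \<open>T\<close> is taken, and the induction hypothesis at \<open>s\<close> supplies the rest of
    the chain and \<open>u\<close>. The gain is rounded down to
    \<open>e\<^sup>2 / 4\<close>.\<close>
  have "\<exists>u\<le>T. real n * (e\<^sup>2 / 4) \<le> h u T" if "T < 0" for n T
    using that
  proof (induction n arbitrary: T)
    case 0
    then show ?case using l by (intro exI[of _ T]) (simp add: h_def)
  next
    case (Suc n)
    obtain s t where st: "s \<le> t" "t \<le> T" and E: "e < (\<integral>\<omega>. \<bar>M t \<omega> - M s \<omega>\<bar> \<partial>P)"
      using bad[OF Suc.prems] by blast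
    obtain u where u: "u \<le> s" "real n * (e\<^sup>2 / 4) \<le> h u s"
      using Suc.IH[of s] st Suc.prems by auto
    have "5 * e / 8 < (h u t - h u s) / (e / 2)"
      using step[OF u(1) st(1)] E st Suc.prems by linarith
    then have "5 * e\<^sup>2 / 16 < h u t - h u s"
      using e by (simp add: field_simps power2_eq_square)
    moreover have "h u t \<le> h u T" using u st by (intro mono) auto
    moreover have "0 < e\<^sup>2" using e by simp
    moreover have "real (Suc n) * (e\<^sup>2 / 4) = real n * (e\<^sup>2 / 4) + e\<^sup>2 / 4"
      by (simp add: algebra_simps)
    ultimately have "real (Suc n) * (e\<^sup>2 / 4) \<le> h u T" using u(2) by linarith
    then show ?case using u(1) st by (intro exI[of _ u]) auto
  qed
  from this[of "-1"] have all: "\<exists>u\<le>-1. real n * (e\<^sup>2 / 4) \<le> h u (-1)" for n by simp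
  obtain n :: nat where n: "4 * l * C / (e\<^sup>2 / 4) < real n" using reals_Archimedean2 by blast
  then have "4 * l * C < real n * (e\<^sup>2 / 4)" using e by (simp add: field_simps)
  moreover obtain u where "u \<le> -1" "real n * (e\<^sup>2 / 4) \<le> h u (-1)" using all by blast
  ultimately show False using h_bound[of u "-1"] by simp
qed

text \<open>Times are chosen so that consecutive differences have summable
  \<open>L\<^sup>1\<close>-norms; the series of differences then converges absolutely almost
  surely.\<close>

lemma exists_AE_convergent_sequence:
  assumes M: "M \<in> increment_martingales P F"
    and cauchy: "\<And>e. 0 < e \<Longrightarrow>
      \<exists>T<0. \<forall>s t. s \<le> t \<longrightarrow> t \<le> T \<longrightarrow> (\<integral>\<omega>. \<bar>M t \<omega> - M s \<omega>\<bar> \<partial>P) \<le> e"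
  shows "\<exists>\<tau>. filterlim \<tau> at_bot sequentially \<and> (AE \<omega> in P. convergent (\<lambda>k. M (\<tau> k) \<omega>))"
proof -
  note int [simp] = integrable_increment[OF M]
  have [measurable]: "M t \<in> borel_measurable P" for t using increment_martingalesD(3)[OF M] .
  have "\<forall>k::nat. \<exists>T<0. \<forall>s t. s \<le> t \<longrightarrow> t \<le> T \<longrightarrow> (\<integral>\<omega>. \<bar>M t \<omega> - M s \<omega>\<bar> \<partial>P) \<le> (1 / 2) ^ k"
    by (intro allI cauchy) simp
  then obtain T where T: "\<And>k s t. s \<le> t \<Longrightarrow> t \<le> T k \<Longrightarrow> (\<integral>\<omega>. \<bar>M t \<omega> - M s \<omega>\<bar> \<partial>P) \<le> (1 / 2) ^ k"
    and T0: "\<And>k::nat. T k < 0"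
    by metis
  \<comment> \<open>The minimum makes \<open>\<tau>\<close> decreasing and keeps
    \<open>\<tau> k\<close> below \<open>T k\<close>; subtracting \<open>k\<close> sends it to minus
    infinity.\<close>
  define \<tau> where "\<tau> k = Min (T ` {..k}) - real k" for k
  have Min_T: "Min (T ` {..k}) \<le> T k" for k
    by (rule Min_le) auto
  have \<tau>_le: "\<tau> k \<le> T k" for k
    unfolding \<tau>_def using Min_T[of k] of_nat_0_le_iff[of k] by linarith
  have \<tau>_mono: "\<tau> (Suc k) \<le> \<tau> k" for k
  proof -
    have "Min (T ` {..Suc k}) \<le> Min (T ` {..k})" by (rule Min_antimono) auto
    then show ?thesis unfolding \<tau>_def by (intro diff_mono) auto
  qed
  have \<tau>_bound: "\<tau> k \<le> - real k" for k
    unfolding \<tau>_def using Min_T[of k] T0[of k] by linarith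
  have "filterlim (\<lambda>k. - real k) at_bot sequentially"
    by (simp add: filterlim_uminus_at_bot filterlim_real_sequentially)
  then have lim: "filterlim \<tau> at_bot sequentially"
    by (rule filterlim_at_bot_mono) (simp add: \<tau>_bound)
  let ?d = "\<lambda>k \<omega>. M (\<tau> k) \<omega> - M (\<tau> (Suc k)) \<omega>"
  have "(\<integral>\<^sup>+\<omega>. (\<Sum>k. ennreal \<bar>?d k \<omega>\<bar>) \<partial>P) = (\<Sum>k. \<integral>\<^sup>+\<omega>. ennreal \<bar>?d k \<omega>\<bar> \<partial>P)"
    by (intro nn_integral_suminf) measurable
  also have "\<dots> \<le> (\<Sum>k. ennreal ((1 / 2) ^ k))"
  proof (intro suminf_le summableI)
    fix k
    have "(\<integral>\<^sup>+\<omega>. ennreal \<bar>?d k \<omega>\<bar> \<partial>P) = ennreal (\<integral>\<omega>. \<bar>?d k \<omega>\<bar> \<partial>P)"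
      by (intro nn_integral_eq_integral) auto
    also have "\<dots> \<le> ennreal ((1 / 2) ^ k)"
      by (intro ennreal_leI T \<tau>_mono \<tau>_le)
    finally show "(\<integral>\<^sup>+\<omega>. ennreal \<bar>?d k \<omega>\<bar> \<partial>P) \<le> ennreal ((1 / 2) ^ k)" .
  qed
  also have "\<dots> < \<infinity>"
    by (subst suminf_ennreal_eq[OF _ geometric_sums]) auto
  finally have "AE \<omega> in P. (\<Sum>k. ennreal \<bar>?d k \<omega>\<bar>) \<noteq> \<infinity>"
    by (intro nn_integral_PInf_AE) auto
  then have "AE \<omega> in P. convergent (\<lambda>k. M (\<tau> k) \<omega>)"
  proof eventually_elim
    case (elim \<omega>)
    then have "summable (\<lambda>k. \<bar>?d k \<omega>\<bar>)"
      by (intro summable_suminf_not_top) auto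
    \<comment> \<open>The sign is changed so that the partial sums telescope to
      \<open>M (\<tau> n) - M (\<tau> 0)\<close>.\<close>
    then have "summable (\<lambda>k. - ?d k \<omega>)"
      by (rule summable_minus[OF summable_rabs_cancel])
    then have "convergent (\<lambda>n. \<Sum>k<n. M (\<tau> (Suc k)) \<omega> - M (\<tau> k) \<omega>)"
      by (simp add: summable_iff_convergent)
    then have "convergent (\<lambda>n. M (\<tau> n) \<omega> - M (\<tau> 0) \<omega>)"
      by (simp add: sum_lessThan_telescope[of "\<lambda>n. M (\<tau> n) \<omega>"])
    then show ?case by (simp add: convergent_diff_const_right_iff)
  qed
  with lim show ?thesis by blast
qed

text \<open>
  Measurability of \<open>M t0 - Z\<close> may be used in proving its integrability: it follows from \<open>Z\<close> being
  an almost sure limit, since the measure is complete.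
\<close>

lemma increment_martingale_shift:
  assumes M: "M \<in> increment_martingales P F"
    and \<tau>: "filterlim \<tau> at_bot sequentially"
    and Z: "AE \<omega> in P. (\<lambda>k. M (\<tau> k) \<omega>) \<longlonglongrightarrow> Z \<omega>"
    and int0: "(\<lambda>\<omega>. M t0 \<omega> - Z \<omega>) \<in> borel_measurable P \<Longrightarrow> integrable P (\<lambda>\<omega>. M t0 \<omega> - Z \<omega>)"
  shows "(\<lambda>t \<omega>. M t \<omega> - Z \<omega>) \<in> martingales P F"
proof -
  note int [simp] = integrable_increment[OF M]
  have [measurable]: "M t \<in> borel_measurable P" for t using increment_martingalesD(3)[OF M] .
  \<comment> \<open>\<open>M\<close> itself need not be adapted, but \<open>M t - Z\<close> is an
    almost sure limit of the increments from \<open>\<tau> k\<close> to \<open>t\<close>, which are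
    \<open>F t\<close>-measurable.\<close>
  have adapted: "(\<lambda>\<omega>. M t \<omega> - Z \<omega>) \<in> borel_measurable (F t)" for t
  proof (rule measurable_F_AE_cong)
    have "incr (\<tau> k) M t \<in> borel_measurable (F t)" for k
      using martingalesD(2)[OF increment_martingalesD(2)[OF M]] .
    then show "(\<lambda>\<omega>. lim (\<lambda>k. incr (\<tau> k) M t \<omega>)) \<in> borel_measurable (F t)"
      by (rule borel_measurable_lim_metric)
    have le: "\<forall>\<^sub>F k in sequentially. \<tau> k \<le> t"
      using \<tau> by (simp add: filterlim_at_bot)
    from Z show "AE \<omega> in P. M t \<omega> - Z \<omega> = lim (\<lambda>k. incr (\<tau> k) M t \<omega>)"
    proof eventually_elim
      case (elim \<omega>)
      then have "(\<lambda>k. M t \<omega> - M (\<tau> k) \<omega>) \<longlonglongrightarrow> M t \<omega> - Z \<omega>" by (intro tendsto_intros)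
      moreover have "\<forall>\<^sub>F k in sequentially. M t \<omega> - M (\<tau> k) \<omega> = incr (\<tau> k) M t \<omega>"
        using le by eventually_elim (simp add: incr_eq)
      ultimately have "(\<lambda>k. incr (\<tau> k) M t \<omega>) \<longlonglongrightarrow> M t \<omega> - Z \<omega>"
        by (rule Lim_transform_eventually)
      then show ?case by (simp add: limI)
    qed
  qed
  have meas: "(\<lambda>\<omega>. M t \<omega> - Z \<omega>) \<in> borel_measurable P" for t
    using adapted by (rule measurable_F_imp_measurable)
  have Zm: "Z \<in> borel_measurable P"
  proof -
    have "(\<lambda>\<omega>. M 0 \<omega> - (M 0 \<omega> - Z \<omega>)) \<in> borel_measurable P"
      by (intro borel_measurable_diff meas) measurable
    moreover have "(\<lambda>\<omega>. M 0 \<omega> - (M 0 \<omega> - Z \<omega>)) = Z" by auto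
    ultimately show ?thesis by simp
  qed
  have intZ: "integrable P (\<lambda>\<omega>. M t \<omega> - Z \<omega>)" for t
  proof -
    have "integrable P (\<lambda>\<omega>. (M t \<omega> - M t0 \<omega>) + (M t0 \<omega> - Z \<omega>))"
      by (intro Bochner_Integration.integrable_add int int0 meas)
    then show ?thesis by simp
  qed
  have "AE \<omega> in P. real_cond_exp P (F s) (\<lambda>\<omega>. M t \<omega> - Z \<omega>) \<omega> = M s \<omega> - Z \<omega>" if st: "s < t" for s t
  proof -
    interpret sigma_finite_subalgebra P "F s" by (rule sigma_finite_subalgebra_F)
    \<comment> \<open>The increment after \<open>s\<close> has conditional expectation 0 given
      \<open>F s\<close>, and \<open>M s - Z\<close> is integrable and
      \<open>F s\<close>-measurable.\<close>
    have eq: "incr s M t \<omega> + (M s \<omega> - Z \<omega>) = M t \<omega> - Z \<omega>" for \<omega>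
      using st by (simp add: incr_def)
    have i: "integrable P (incr s M t)" using martingalesD(3)[OF increment_martingalesD(2)[OF M]] .
    have "AE \<omega> in P. real_cond_exp P (F s) (incr s M t) \<omega> = incr s M s \<omega>"
      using martingalesD(4)[OF increment_martingalesD(2)[OF M] st] .
    moreover have "AE \<omega> in P. real_cond_exp P (F s) (\<lambda>\<omega>. M s \<omega> - Z \<omega>) \<omega> = M s \<omega> - Z \<omega>"
      by (intro real_cond_exp_F_meas intZ adapted)
    moreover have "AE \<omega> in P. real_cond_exp P (F s) (\<lambda>\<omega>. incr s M t \<omega> + (M s \<omega> - Z \<omega>)) \<omega>
        = real_cond_exp P (F s) (incr s M t) \<omega> + real_cond_exp P (F s) (\<lambda>\<omega>. M s \<omega> - Z \<omega>) \<omega>"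
      by (intro real_cond_exp_add i intZ)
    ultimately show ?thesis
      unfolding eq by eventually_elim (simp add: incr_def)
  qed
  moreover have "cadlag_process P (\<lambda>t \<omega>. M t \<omega> - Z \<omega>)"
    using increment_martingalesD(1)[OF M] Zm by (rule cadlag_process_diff_const_path)
  ultimately show ?thesis
    using adapted intZ by (simp add: martingales_def)
qed

text \<open>A limit \<open>L\<close> is available only along a sequence at first. Fatou's lemma
  carries the Cauchy estimate over to \<open>M t - L\<close>, and the maximal inequality for the
  martingale \<open>M - L\<close> then upgrades this to almost sure convergence along all
  times.\<close>

lemma increment_martingale_converges:
  assumes M: "M \<in> increment_martingales P F"
    and ui: "\<And>e. 0 < e \<Longrightarrow> \<exists>c>0. \<forall>s<0. (\<integral>\<omega>. tail c (M 0 \<omega> - M s \<omega>) \<partial>P) \<le> e"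
  shows "AE \<omega> in P. has_lim_minus_inf M \<omega>"
    and "(\<lambda>t \<omega>. M t \<omega> - lim_minus_inf M \<omega>) \<in> martingales P F"
proof -
  note int [simp] = integrable_increment[OF M]
  have [measurable]: "M t \<in> borel_measurable P" for t using increment_martingalesD(3)[OF M] .
  have cauchy: "\<exists>T<0. \<forall>s t. s \<le> t \<longrightarrow> t \<le> T \<longrightarrow> (\<integral>\<omega>. \<bar>M t \<omega> - M s \<omega>\<bar> \<partial>P) \<le> e" if "0 < e" for e
    using L1_Cauchy_at_bot[OF M _ that] ui by blast
  obtain \<tau> where \<tau>: "filterlim \<tau> at_bot sequentially" and conv: "AE \<omega> in P. convergent (\<lambda>k. M (\<tau> k) \<omega>)"
    using exists_AE_convergent_sequence[OF M cauchy] by auto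
  define L where "L \<omega> = lim (\<lambda>k. M (\<tau> k) \<omega>)" for \<omega>
  have [measurable]: "L \<in> borel_measurable P"
    unfolding L_def by (rule borel_measurable_lim_metric) measurable
  have L: "AE \<omega> in P. (\<lambda>k. M (\<tau> k) \<omega>) \<longlonglongrightarrow> L \<omega>"
    using conv by eventually_elim (simp add: L_def convergent_LIMSEQ_iff)
  have fatou: "\<exists>T<0. \<forall>t\<le>T. (\<integral>\<^sup>+\<omega>. ennreal \<bar>M t \<omega> - L \<omega>\<bar> \<partial>P) \<le> ennreal e" if e: "0 < e" for e
  proof -
    obtain T where T: "T < 0" "\<And>s t. s \<le> t \<Longrightarrow> t \<le> T \<Longrightarrow> (\<integral>\<omega>. \<bar>M t \<omega> - M s \<omega>\<bar> \<partial>P) \<le> e"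
      using cauchy[OF e] by blast
    have "(\<integral>\<^sup>+\<omega>. ennreal \<bar>M t \<omega> - L \<omega>\<bar> \<partial>P) \<le> ennreal e" if "t \<le> T" for t
    proof (rule nn_integral_le_of_AE_tendsto)
      show "AE \<omega> in P. (\<lambda>k. \<bar>M t \<omega> - M (\<tau> k) \<omega>\<bar>) \<longlonglongrightarrow> \<bar>M t \<omega> - L \<omega>\<bar>"
        using L by eventually_elim (intro tendsto_intros)
      have "\<forall>\<^sub>F k in sequentially. \<tau> k \<le> t"
        using \<tau> by (simp add: filterlim_at_bot)
      then show "\<forall>\<^sub>F k in sequentially. (\<integral>\<^sup>+\<omega>. ennreal \<bar>M t \<omega> - M (\<tau> k) \<omega>\<bar> \<partial>P) \<le> ennreal e"
      proof eventually_elim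
        case (elim k)
        have "(\<integral>\<^sup>+\<omega>. ennreal \<bar>M t \<omega> - M (\<tau> k) \<omega>\<bar> \<partial>P) = ennreal (\<integral>\<omega>. \<bar>M t \<omega> - M (\<tau> k) \<omega>\<bar> \<partial>P)"
          by (intro nn_integral_eq_integral) auto
        also have "\<dots> \<le> ennreal e" using elim that by (intro ennreal_leI T(2))
        finally show ?case .
      qed
    qed measurable
    then show ?thesis using T(1) by blast
  qed
  obtain t0 where t0: "(\<integral>\<^sup>+\<omega>. ennreal \<bar>M t0 \<omega> - L \<omega>\<bar> \<partial>P) \<le> ennreal 1"
    using fatou[of 1] by auto
  have intL: "integrable P (\<lambda>\<omega>. M t0 \<omega> - L \<omega>)"
    using t0 by (intro integrableI_bounded) (auto intro: le_less_trans)
  have N: "(\<lambda>t \<omega>. M t \<omega> - L \<omega>) \<in> martingales P F"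
    using increment_martingale_shift[OF M \<tau> L intL] .
  have "((\<lambda>t. \<integral>\<omega>. \<bar>M t \<omega> - L \<omega>\<bar> \<partial>P) \<longlongrightarrow> 0) at_bot"
  proof (rule tendstoI)
    fix e :: real assume "0 < e"
    then obtain T where T: "\<And>t. t \<le> T \<Longrightarrow> (\<integral>\<^sup>+\<omega>. ennreal \<bar>M t \<omega> - L \<omega>\<bar> \<partial>P) \<le> ennreal (e / 2)"
      using fatou[of "e / 2"] by auto
    have "\<bar>\<integral>\<omega>. \<bar>M t \<omega> - L \<omega>\<bar> \<partial>P\<bar> < e" if "t \<le> T" for t
    proof -
      have "(\<integral>\<^sup>+\<omega>. ennreal \<bar>M t \<omega> - L \<omega>\<bar> \<partial>P) = ennreal (\<integral>\<omega>. \<bar>M t \<omega> - L \<omega>\<bar> \<partial>P)"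
        using martingalesD(3)[OF N, of t] by (intro nn_integral_eq_integral) auto
      then have "(\<integral>\<omega>. \<bar>M t \<omega> - L \<omega>\<bar> \<partial>P) \<le> e / 2"
        using T[OF that] \<open>0 < e\<close> by simp
      then show ?thesis using \<open>0 < e\<close> by simp
    qed
    then show "\<forall>\<^sub>F t in at_bot. dist (\<integral>\<omega>. \<bar>M t \<omega> - L \<omega>\<bar> \<partial>P) 0 < e"
      unfolding eventually_at_bot_linorder by auto
  qed
  from martingale_AE_tendsto_0_at_bot[OF N this]
  have lim: "AE \<omega> in P. ((\<lambda>t. M t \<omega>) \<longlongrightarrow> L \<omega>) at_bot"
    by eventually_elim (simp add: Lim_null[symmetric])
  then show "AE \<omega> in P. has_lim_minus_inf M \<omega>"
    by eventually_elim (rule lim_minus_infI)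
  have eq: "AE \<omega> in P. lim_minus_inf M \<omega> = L \<omega>"
    using lim by eventually_elim (rule lim_minus_infI)
  \<comment> \<open>\<open>L\<close> and \<open>lim_minus_inf M\<close> agree only almost surely, so
    the shift lemma is applied again; it provides the measurability needed to transfer integrability
    from \<open>M t0 - L\<close>.\<close>
  show "(\<lambda>t \<omega>. M t \<omega> - lim_minus_inf M \<omega>) \<in> martingales P F"
  proof (rule increment_martingale_shift[OF M \<tau>])
    show "AE \<omega> in P. (\<lambda>k. M (\<tau> k) \<omega>) \<longlonglongrightarrow> lim_minus_inf M \<omega>"
      using L eq by eventually_elim simp
    show "integrable P (\<lambda>\<omega>. M t0 \<omega> - lim_minus_inf M \<omega>)"
      if "(\<lambda>\<omega>. M t0 \<omega> - lim_minus_inf M \<omega>) \<in> borel_measurable P"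
    proof (rule integrable_cong_AE_imp[OF intL that])
      show "AE \<omega> in P. M t0 \<omega> - L \<omega> = M t0 \<omega> - lim_minus_inf M \<omega>"
        using eq by eventually_elim simp
    qed
  qed
qed

subsection \<open>Increments of martingales\<close>

text \<open>The process frozen at time \<open>s\<close>, \<open>N (min t s)\<close>, is again a
  martingale: given \<open>F u\<close>, either its value at \<open>t\<close> is already known at
  time \<open>u\<close>, or \<open>u < min t s\<close> and the martingale property of
  \<open>N\<close> applies. The increment process is the difference of the two.\<close>

lemma incr_martingale:
  assumes N: "N \<in> martingales P F"
  shows "incr s N \<in> martingales P F"
proof -
  have adapted: "incr s N t \<in> borel_measurable (F t)" for t
    unfolding incr_def
    using measurable_F_mono[OF martingalesD(2)[OF N]] martingalesD(2)[OF N]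
    by (intro borel_measurable_diff) auto
  have int: "integrable P (incr s N t)" for t
    unfolding incr_def using martingalesD(3)[OF N] by auto
  have "AE \<omega> in P. real_cond_exp P (F u) (incr s N t) \<omega> = incr s N u \<omega>" if "u < t" for u t
  proof -
    interpret sigma_finite_subalgebra P "F u" by (rule sigma_finite_subalgebra_F)
    have "AE \<omega> in P. real_cond_exp P (F u) (N (min t s)) \<omega> = N (min u s) \<omega>"
    proof (cases "min t s \<le> u")
      case True
      then have "min t s = min u s" using that by auto
      then show ?thesis
        using measurable_F_mono[OF martingalesD(2)[OF N] True] martingalesD(3)[OF N]
        by (metis real_cond_exp_F_meas)
    next
      case False
      then have "u < min t s" "min u s = u" by auto
      then show ?thesis using martingalesD(4)[OF N] by metis
    qed
    moreover have "AE \<omega> in P. real_cond_exp P (F u) (N t) \<omega> = N u \<omega>"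
      using martingalesD(4)[OF N that] .
    moreover have "AE \<omega> in P. real_cond_exp P (F u) (\<lambda>\<omega>. N t \<omega> - N (min t s) \<omega>) \<omega>
       = real_cond_exp P (F u) (N t) \<omega> - real_cond_exp P (F u) (N (min t s)) \<omega>"
      by (intro real_cond_exp_diff martingalesD(3)[OF N])
    ultimately show ?thesis
      unfolding incr_def by eventually_elim simp
  qed
  then show ?thesis
    using adapted int cadlag_incr[OF martingalesD(1)[OF N]] by (simp add: martingales_def)
qed

text \<open>On the \<open>F s\<close>-event that \<open>|N s|\<close> exceeds \<open>a\<close>, the
  submartingale property replaces \<open>|N s|\<close> by \<open>|N t|\<close>, which is at most
  \<open>b\<close> plus its tail. On that event \<open>b\<close> is at most
  \<open>b / a * |N s|\<close>, as in Markov's inequality.\<close>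

lemma martingale_tail_le:
  assumes N: "N \<in> martingales P F" and st: "s \<le> t" and b: "0 < b" and a: "0 < a"
  shows "(\<integral>\<omega>. tail a (N s \<omega>) \<partial>P) \<le> (\<integral>\<omega>. tail b (N t \<omega>) \<partial>P) + b / a * (\<integral>\<omega>. \<bar>N t \<omega>\<bar> \<partial>P)"
proof -
  note int [simp] = martingalesD(3)[OF N]
  define A where "A = {\<omega>\<in>space P. a < \<bar>N s \<omega>\<bar>}"
  have [measurable]: "N s \<in> borel_measurable (F s)" using martingalesD(2)[OF N] .
  have "{\<omega>\<in>space (F s). a < \<bar>N s \<omega>\<bar>} \<in> sets (F s)" by measurable
  then have A: "A \<in> sets (F s)" by (simp add: A_def space_F_eq)
  then have AP [measurable]: "A \<in> sets P" using subalgebra_F by (auto simp: subalgebra_def)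
  have "(\<integral>\<omega>. tail a (N s \<omega>) \<partial>P) = (\<integral>\<omega>. \<bar>N s \<omega>\<bar> * indicator A \<omega> \<partial>P)"
    by (intro Bochner_Integration.integral_cong) (auto simp: A_def tail_def indicator_def)
  also have "\<dots> \<le> (\<integral>\<omega>. \<bar>N t \<omega>\<bar> * indicator A \<omega> \<partial>P)"
    by (rule martingale_abs_set_integral_mono[OF N st A])
  also have "\<dots> \<le> (\<integral>\<omega>. tail b (N t \<omega>) + b / a * \<bar>N s \<omega>\<bar> \<partial>P)"
  proof (rule integral_mono)
    show "integrable P (\<lambda>\<omega>. \<bar>N t \<omega>\<bar> * indicator A \<omega>)"
      by (intro integrable_real_mult_indicator) auto
    show "integrable P (\<lambda>\<omega>. tail b (N t \<omega>) + b / a * \<bar>N s \<omega>\<bar>)"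
      by (intro Bochner_Integration.integrable_add integrable_mult_right integrable_tail integrable_abs int)
    show "\<bar>N t \<omega>\<bar> * indicator A \<omega> \<le> tail b (N t \<omega>) + b / a * \<bar>N s \<omega>\<bar>" for \<omega>
    proof (cases "\<omega> \<in> A")
      case True
      then have "b / a * a \<le> b / a * \<bar>N s \<omega>\<bar>"
        using a b by (intro mult_left_mono) (auto simp: A_def)
      then have "b \<le> b / a * \<bar>N s \<omega>\<bar>" using a by simp
      then show ?thesis using True abs_le_add_tail[of b "N t \<omega>"] b by simp
    qed (use a b in \<open>simp add: tail_nonneg\<close>)
  qed
  also have "\<dots> = (\<integral>\<omega>. tail b (N t \<omega>) \<partial>P) + b / a * (\<integral>\<omega>. \<bar>N s \<omega>\<bar> \<partial>P)"
    by (simp add: integrable_tail)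
  also have "\<dots> \<le> (\<integral>\<omega>. tail b (N t \<omega>) \<partial>P) + b / a * (\<integral>\<omega>. \<bar>N t \<omega>\<bar> \<partial>P)"
  proof -
    have "(\<integral>\<omega>. \<bar>N s \<omega>\<bar> \<partial>P) \<le> (\<integral>\<omega>. \<bar>N t \<omega>\<bar> \<partial>P)"
      using martingale_abs_set_integral_mono[OF N st sets.top]
      by (simp add: space_F_eq indicator_def cong: Bochner_Integration.integral_cong)
    then show ?thesis using a b by (intro add_left_mono mult_left_mono) auto
  qed
  finally show ?thesis .
qed

lemma martingale_increments_uniform_tail:
  assumes N: "N \<in> martingales P F" and e: "0 < e"
  shows "\<exists>c>0. \<forall>s\<le>t. (\<integral>\<omega>. tail c (N t \<omega> - N s \<omega>) \<partial>P) \<le> e"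
proof -
  note int [simp] = martingalesD(3)[OF N]
  obtain b where b: "0 < b" "(\<integral>\<omega>. tail b (N t \<omega>) \<partial>P) \<le> e / 6"
    using integral_tail_small[OF int, of "e / 6"] e by auto
  define K where "K = (\<integral>\<omega>. \<bar>N t \<omega>\<bar> \<partial>P)"
  have K: "0 \<le> K" by (simp add: K_def)
  \<comment> \<open>The second summand gives \<open>b / a * K \<le> e / 6\<close>, the first gives
    \<open>b \<le> a\<close>. The final bound is
    \<open>2 * (e / 6) + 2 * (e / 6 + e / 6) = e\<close>.\<close>
  define a where "a = b + 6 * b * K / e"
  have a: "b \<le> a" "0 < a" using b(1) K e by (auto simp: a_def intro: add_pos_nonneg)
  have baK: "b / a * K \<le> e / 6"
  proof -
    have "b * K * 6 \<le> a * e" using e b(1) by (simp add: a_def field_simps)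
    then show ?thesis using a(2) by (simp add: field_simps)
  qed
  have "(\<integral>\<omega>. tail (2 * a) (N t \<omega> - N s \<omega>) \<partial>P) \<le> e" if st: "s \<le> t" for s
  proof -
    have "(\<integral>\<omega>. tail (2 * a) (N t \<omega> - N s \<omega>) \<partial>P) \<le> (\<integral>\<omega>. 2 * tail a (N t \<omega>) + 2 * tail a (N s \<omega>) \<partial>P)"
      by (intro integral_mono tail_diff_le Bochner_Integration.integrable_add integrable_mult_right
          integrable_tail Bochner_Integration.integrable_diff int)
    also have "\<dots> = 2 * (\<integral>\<omega>. tail a (N t \<omega>) \<partial>P) + 2 * (\<integral>\<omega>. tail a (N s \<omega>) \<partial>P)"
      by (simp add: integrable_tail)
    also have "(\<integral>\<omega>. tail a (N t \<omega>) \<partial>P) \<le> (\<integral>\<omega>. tail b (N t \<omega>) \<partial>P)"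
      using a(1) by (intro integral_mono tail_antimono integrable_tail int)
    also have "(\<integral>\<omega>. tail a (N s \<omega>) \<partial>P) \<le> e / 6 + e / 6"
      using martingale_tail_le[OF N st b(1) a(2)] b(2) baK unfolding K_def by linarith
    finally show ?thesis using b(2) by simp
  qed
  then show ?thesis using a(2) by (intro exI[of _ "2 * a"]) auto
qed

text \<open>Orthogonality of \<open>N s\<close> and \<open>N t - N s\<close>. As \<open>N s\<close>
  may be unbounded, \<open>martingale_mult_bounded\<close> does not apply; square integrability
  makes the products integrable instead.\<close>

lemma square_integrable_martingale_increment_le:
  assumes N: "N \<in> square_integrable_martingales P F" and st: "s \<le> t"
  shows "(\<integral>\<omega>. (N t \<omega> - N s \<omega>)\<^sup>2 \<partial>P) \<le> (\<integral>\<omega>. (N t \<omega>)\<^sup>2 \<partial>P)"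
proof -
  have NM: "N \<in> martingales P F" and sq [simp]: "integrable P (\<lambda>\<omega>. (N t \<omega>)\<^sup>2)" for t
    using N by (auto simp: square_integrable_martingales_def)
  have [measurable]: "N t \<in> borel_measurable P" for t using martingalesD(5)[OF NM] .
  have prod [simp]: "integrable P (\<lambda>\<omega>. N s \<omega> * N t \<omega>)" for s t
    by (rule integrable_mult_of_squares) auto
  have "(\<integral>\<omega>. N s \<omega> * N t \<omega> \<partial>P) = (\<integral>\<omega>. (N s \<omega>)\<^sup>2 \<partial>P)"
  proof (cases "s = t")
    case False
    interpret sigma_finite_subalgebra P "F s" by (rule sigma_finite_subalgebra_F)
    have "(\<integral>\<omega>. N s \<omega> * N t \<omega> \<partial>P) = (\<integral>\<omega>. N s \<omega> * real_cond_exp P (F s) (N t) \<omega> \<partial>P)"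
      using martingalesD(2)[OF NM] by (intro real_cond_exp_intg(2)[symmetric]) auto
    also have "\<dots> = (\<integral>\<omega>. N s \<omega> * N s \<omega> \<partial>P)"
      using martingalesD(4)[OF NM, of s t] st False by (intro integral_cong_AE) auto
    finally show ?thesis by (simp add: power2_eq_square)
  qed (simp add: power2_eq_square)
  then have "(\<integral>\<omega>. (N t \<omega> - N s \<omega>)\<^sup>2 \<partial>P) = (\<integral>\<omega>. (N t \<omega>)\<^sup>2 \<partial>P) - (\<integral>\<omega>. (N s \<omega>)\<^sup>2 \<partial>P)"
    by (simp add: power2_diff mult.commute[of "N t _"] mult.assoc)
  then show ?thesis by simp
qed

lemma incr_square_integrable_martingale:
  assumes N: "N \<in> square_integrable_martingales P F"
  shows "incr s N \<in> square_integrable_martingales P F"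
proof -
  have NM: "N \<in> martingales P F" and sq: "integrable P (\<lambda>\<omega>. (N t \<omega>)\<^sup>2)" for t
    using N by (auto simp: square_integrable_martingales_def)
  have "integrable P (\<lambda>\<omega>. (incr s N t \<omega>)\<^sup>2)" for t
    unfolding incr_def using martingalesD(5)[OF NM] sq by (intro integrable_diff_square) auto
  then show ?thesis
    using incr_martingale[OF NM] by (simp add: square_integrable_martingales_def)
qed

end

theorem proposition3p9:
  fixes P :: "'a measure" and F :: "real \<Rightarrow> 'a measure" and M :: "real \<Rightarrow> 'a \<Rightarrow> real"
  assumes "complete_filtered_prob_space P F"
    and "cadlag_process P M"
  shows "(((AE \<omega> in P. has_lim_minus_inf M \<omega>) \<and>
            (\<lambda>t \<omega>. M t \<omega> - lim_minus_inf M \<omega>) \<in> martingales P F)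
          \<longleftrightarrow>
          (M \<in> increment_martingales P F \<and>
            uniformly_integrable P {..<0} (\<lambda>s. incr s M 0)))
       \<and>
         (((AE \<omega> in P. has_lim_minus_inf M \<omega>) \<and>
            (\<lambda>t \<omega>. M t \<omega> - lim_minus_inf M \<omega>) \<in> square_integrable_martingales P F)
          \<longleftrightarrow>
          (M \<in> increment_square_integrable_martingales P F \<and>
            (SUP s\<in>{..0}. \<integral>\<^sup>+\<omega>. ennreal ((incr s M 0 \<omega>)\<^sup>2) \<partial>P) < \<infinity>))"
proof -
  interpret complete_filtered_prob_space P F by fact
  let ?N = "\<lambda>t \<omega>. M t \<omega> - lim_minus_inf M \<omega>"
  \<comment> \<open>Increments do not see the shift, so those of \<open>M\<close> can be studied
    through \<open>?N\<close>.\<close>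
  have shift: "incr s M = incr s ?N" for s by (rule incr_shift[symmetric])
  have IM: "M \<in> increment_martingales P F" if "?N \<in> martingales P F"
    using assms(2) incr_martingale[OF that] by (simp add: increment_martingales_def shift)
  have ui_iff: "uniformly_integrable P {..<0} (\<lambda>s. incr s M 0) \<longleftrightarrow>
      (\<forall>e>0. \<exists>c>0. \<forall>s<0. (\<integral>\<omega>. tail c (M 0 \<omega> - M s \<omega>) \<partial>P) \<le> e)"
    if "M \<in> increment_martingales P F"
  proof -
    have "uniformly_integrable P {..<0} (\<lambda>s. incr s M 0) \<longleftrightarrow>
      (\<forall>e>0. \<exists>c>0. \<forall>s\<in>{..<0}. (\<integral>\<omega>. tail c (incr s M 0 \<omega>) \<partial>P) \<le> e)"
      using integrable_increment[OF that]
      by (intro uniformly_integrable_iff_tail) (simp add: incr_eq)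
    then show ?thesis by (simp add: Ball_def incr_eq)
  qed
  have ab: "M \<in> increment_martingales P F \<and> uniformly_integrable P {..<0} (\<lambda>s. incr s M 0)"
    if "?N \<in> martingales P F"
    using IM[OF that] martingale_increments_uniform_tail[OF that, of _ 0]
    by (force simp: ui_iff)
  have ba: "(AE \<omega> in P. has_lim_minus_inf M \<omega>) \<and> ?N \<in> martingales P F"
    if "M \<in> increment_martingales P F" "uniformly_integrable P {..<0} (\<lambda>s. incr s M 0)"
    using increment_martingale_converges[OF that(1)] that(2) ui_iff[OF that(1)] by blast
  have cd: "M \<in> increment_square_integrable_martingales P F \<and>
            (SUP s\<in>{..0}. \<integral>\<^sup>+\<omega>. ennreal ((incr s M 0 \<omega>)\<^sup>2) \<partial>P) < \<infinity>"
    if N: "?N \<in> square_integrable_martingales P F"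
  proof
    have NM: "?N \<in> martingales P F" using N by (simp add: square_integrable_martingales_def)
    show "M \<in> increment_square_integrable_martingales P F"
      using IM[OF NM] incr_square_integrable_martingale[OF N]
      by (simp add: increment_square_integrable_martingales_def shift)
    have "(\<integral>\<^sup>+\<omega>. ennreal ((incr s M 0 \<omega>)\<^sup>2) \<partial>P) \<le> ennreal (\<integral>\<omega>. (?N 0 \<omega>)\<^sup>2 \<partial>P)" if "s \<le> 0" for s
    proof -
      have "integrable P (\<lambda>\<omega>. (incr s M 0 \<omega>)\<^sup>2)"
        using incr_square_integrable_martingale[OF N, of s]
        by (simp add: square_integrable_martingales_def shift)
      then have "(\<integral>\<^sup>+\<omega>. ennreal ((incr s M 0 \<omega>)\<^sup>2) \<partial>P) = ennreal (\<integral>\<omega>. (incr s M 0 \<omega>)\<^sup>2 \<partial>P)"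
        by (intro nn_integral_eq_integral) auto
      also have "\<dots> = ennreal (\<integral>\<omega>. (?N 0 \<omega> - ?N s \<omega>)\<^sup>2 \<partial>P)"
        using that by (simp add: incr_eq)
      also have "\<dots> \<le> ennreal (\<integral>\<omega>. (?N 0 \<omega>)\<^sup>2 \<partial>P)"
        using square_integrable_martingale_increment_le[OF N that] by (rule ennreal_leI)
      finally show ?thesis .
    qed
    then have "(SUP s\<in>{..0}. \<integral>\<^sup>+\<omega>. ennreal ((incr s M 0 \<omega>)\<^sup>2) \<partial>P) \<le> ennreal (\<integral>\<omega>. (?N 0 \<omega>)\<^sup>2 \<partial>P)"
      by (intro SUP_least) auto
    then show "(SUP s\<in>{..0}. \<integral>\<^sup>+\<omega>. ennreal ((incr s M 0 \<omega>)\<^sup>2) \<partial>P) < \<infinity>"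
      by (rule le_less_trans) simp
  qed
  \<comment> \<open>The \<open>L\<^sup>2\<close> bound implies uniform integrability, so the limit
    exists and \<open>?N\<close> is a martingale; it remains to bound its second moments.\<close>
  have dc: "(AE \<omega> in P. has_lim_minus_inf M \<omega>) \<and> ?N \<in> square_integrable_martingales P F"
    if M2: "M \<in> increment_square_integrable_martingales P F"
      and fin: "(SUP s\<in>{..0}. \<integral>\<^sup>+\<omega>. ennreal ((incr s M 0 \<omega>)\<^sup>2) \<partial>P) < \<infinity>"
  proof -
    have M: "M \<in> increment_martingales P F"
      and sq: "integrable P (\<lambda>\<omega>. (incr s M t \<omega>)\<^sup>2)" for s t
      using M2 by (auto simp: increment_square_integrable_martingales_def square_integrable_martingales_def)
    have [measurable]: "M t \<in> borel_measurable P" for t using increment_martingalesD(3)[OF M] .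
    obtain K where K: "0 \<le> K" "(SUP s\<in>{..0}. \<integral>\<^sup>+\<omega>. ennreal ((incr s M 0 \<omega>)\<^sup>2) \<partial>P) = ennreal K"
      using fin by (cases "SUP s\<in>{..0}. \<integral>\<^sup>+\<omega>. ennreal ((incr s M 0 \<omega>)\<^sup>2) \<partial>P") auto
    have nnK: "(\<integral>\<^sup>+\<omega>. ennreal ((M 0 \<omega> - M s \<omega>)\<^sup>2) \<partial>P) \<le> ennreal K" if "s \<le> 0" for s
    proof -
      have "(\<integral>\<^sup>+\<omega>. ennreal ((incr s M 0 \<omega>)\<^sup>2) \<partial>P) \<le> ennreal K"
        unfolding K(2)[symmetric] using that by (intro SUP_upper) auto
      then show ?thesis using that by (simp add: incr_eq)
    qed
    have sq': "integrable P (\<lambda>\<omega>. (M t \<omega> - M s \<omega>)\<^sup>2)" for s t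
      using sq[of "min s t" "max s t"] by (auto simp: incr_def min_def max_def power2_commute split: if_splits)
    have "\<exists>c>0. \<forall>s<0. (\<integral>\<omega>. tail c (M 0 \<omega> - M s \<omega>) \<partial>P) \<le> e" if "0 < e" for e
    proof (intro exI conjI allI impI)
      \<comment> \<open>Adding 1 keeps the threshold positive when \<open>K = 0\<close>; then
        \<open>K / ?c = K * e / (K + 1) \<le> e\<close>.\<close>
      let ?c = "(K + 1) / e"
      show c: "0 < ?c" using K(1) that by simp
      fix s :: real assume s: "s < 0"
      have "(\<integral>\<^sup>+\<omega>. ennreal ((M 0 \<omega> - M s \<omega>)\<^sup>2) \<partial>P) = ennreal (\<integral>\<omega>. (M 0 \<omega> - M s \<omega>)\<^sup>2 \<partial>P)"
        by (intro nn_integral_eq_integral sq') auto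
      then have int_le: "(\<integral>\<omega>. (M 0 \<omega> - M s \<omega>)\<^sup>2 \<partial>P) \<le> K"
        using nnK[of s] s K(1) by simp
      have "(\<integral>\<omega>. tail ?c (M 0 \<omega> - M s \<omega>) \<partial>P) \<le> (\<integral>\<omega>. (M 0 \<omega> - M s \<omega>)\<^sup>2 / ?c \<partial>P)"
        using c by (intro integral_mono integrable_tail tail_le_square integrable_increment[OF M])
          (auto intro: sq' simp del: divide_divide_eq_right)
      also have "\<dots> = (\<integral>\<omega>. (M 0 \<omega> - M s \<omega>)\<^sup>2 \<partial>P) / ?c" by simp
      also have "\<dots> \<le> K / ?c"
        using int_le c by (intro divide_right_mono) auto
      also have "\<dots> \<le> e" using K(1) that by (simp add: field_simps)
      finally show "(\<integral>\<omega>. tail ?c (M 0 \<omega> - M s \<omega>) \<partial>P) \<le> e" .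
    qed
    note conv = increment_martingale_converges[OF M this]
    have lim: "AE \<omega> in P. has_lim_minus_inf M \<omega>" and NM: "?N \<in> martingales P F"
      using conv by auto
    have [measurable]: "?N t \<in> borel_measurable P" for t using martingalesD(5)[OF NM] .
    have "(\<integral>\<^sup>+\<omega>. ennreal ((?N 0 \<omega>)\<^sup>2) \<partial>P) \<le> ennreal K"
    proof (rule nn_integral_le_of_AE_tendsto)
      have "filterlim (\<lambda>k. - real k) at_bot sequentially"
        by (simp add: filterlim_uminus_at_bot filterlim_real_sequentially)
      then show "AE \<omega> in P. (\<lambda>k. (M 0 \<omega> - M (- real k) \<omega>)\<^sup>2) \<longlonglongrightarrow> (?N 0 \<omega>)\<^sup>2"
        using lim by (auto elim!: eventually_mono intro!: tendsto_intros
            filterlim_compose[OF lim_minus_inf_tendsto])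
    qed (auto intro!: nnK always_eventually)
    then have N0: "integrable P (\<lambda>\<omega>. (?N 0 \<omega>)\<^sup>2)"
      by (intro integrableI_bounded) (auto intro: le_less_trans)
    have "integrable P (\<lambda>\<omega>. (?N t \<omega>)\<^sup>2)" for t
    proof -
      \<comment> \<open>Square integrability passes from time 0 to time \<open>t\<close> because
        \<open>?N t\<close> is \<open>?N 0\<close> minus a square integrable increment.\<close>
      have "integrable P (\<lambda>\<omega>. (?N 0 \<omega> - (M 0 \<omega> - M t \<omega>))\<^sup>2)"
        by (intro integrable_diff_square N0 sq') measurable
      then show ?thesis by (simp add: algebra_simps)
    qed
    then show ?thesis using lim NM by (simp add: square_integrable_martingales_def)
  qed
  show ?thesis
    by (rule conjI; rule iffI; erule conjE) (rule ab ba cd dc, assumption+)+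
qed

end
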